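(* Let $T$ be an $n$-tournament with $n\ge 2$. Then: (i) $T\in\mathcal{D}_1$ if and only if $T$ is switching equivalent to a transitive blowup of $L_2$; (ii) $T\in\mathcal{D}_3\setminus\mathcal{D}_1$ if and only if $T$ is switching equivalent to a transitive blowup of $L_4$; (iii) $T\in\mathcal{D}_3$ if and only if $T$ is switching equivalent to a transitive blowup of $L_k$ for some $k\in\{2,4\}$; (iv) $T\in\mathcal{D}_5\setminus\mathcal{D}_3$ if and only if $T$ is switching equivalent to a transitive blowup of $L_6$; (v) $T\in\mathcal{D}_5$ if and only if $T$ is switching equivalent to a transitive blowup of $L_k$ for some $k\in\{2,4,6\}$.
   Context: A tournament is a directed graph with exactly one arc between each pair of distinct vertices; $u\rightarrow v$ means the arc goes from $u$ to $v$; an $n$-tournament has $n$ vertices. For a tournament $T$ on vertices $v_1,\dots,v_n$, its skew-adjacency matrix is the zero-diagonal matrix $S_T=[s_{ij}]$ with $s_{ij}=-s_{ji}=1$ if $v_i\rightarrow v_j$, and $\det(T):=\det(S_T)$. A subtournament of $T$ is the tournament induced by a nonempty vertex subset (including $T$ itself). For a positive odd integer $k$, $\mathcal{D}_k$ is the set of tournaments all of whose subtournaments have determinant at most $k^2$. A tournament is transitive if it has no directed 3-cycle. The switch of $T$ with respect to $W\subseteq V(T)$ is obtained by reversing all arcs between $W$ and $V(T)\setminus W$; switching equivalent means one is a switch of the other. For an $n$-tournament $R$ with vertices $v_1,\dots,v_n$ and positive integers $a_1,\dots,a_n$, the transitive blowup $R(a_1,\dots,a_n)$ replaces each $v_i$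 by a transitive tournament on $a_i$ vertices, with all arcs from the $i$-th block to the $j$-th block whenever $v_i\rightarrow v_j$ in $R$. For $m\ge 2$, $L_m$ is the tournament on vertices $u_1,\dots,u_m$ with $u_i\rightarrow u_j$ for $1\le i<j\le m-1$, and for $1\le i\le m-1$: $u_m\rightarrow u_i$ if $i$ is odd and $u_i\rightarrow u_m$ if $i$ is even. *)

theory Defs
  imports "Graph_Theory.Graph_Theory" "Jordan_Normal_Form.Determinant"
begin

locale tournament = pair_digraph T for T :: "'a pair_pre_digraph" +
  assumes one_arc: "u \<in> pverts T \<Longrightarrow> v \<in> pverts T \<Longrightarrow> u \<noteq> v \<Longrightarrow>
    ((u, v) \<in> parcs T) \<noteq> ((v, u) \<in> parcs T)"

lemma tournamentI:
  assumes "finite (pverts T)" "parcs T \<subseteq> pverts T \<times> pverts T"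
    "\<And>u. (u, u) \<notin> parcs T"
    "\<And>u v. u \<in> pverts T \<Longrightarrow> v \<in> pverts T \<Longrightarrow> u \<noteq> v \<Longrightarrow>
      ((u, v) \<in> parcs T) \<noteq> ((v, u) \<in> parcs T)"
  shows "tournament T"
proof
  show "fst e \<in> pverts T" "snd e \<in> pverts T" if "e \<in> parcs T" for e
    using subsetD[OF assms(2) that] by (simp_all add: mem_Times_iff)
  show "fst e \<noteq> snd e" if "e \<in> parcs T" for e
    using that assms(3)[of "fst e"] by (cases e) auto
  show "finite (pverts T)" by (rule assms(1))
  show "finite (parcs T)"
    using assms(1,2) by (meson finite_SigmaI finite_subset)
  show "((u, v) \<in> parcs T) \<noteq> ((v, u) \<in> parcs T)"
    if "u \<in> pverts T" "v \<in> pverts T" "u \<noteq> v" for u v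
    using assms(4) that .
qed

definition induced :: "'a pair_pre_digraph \<Rightarrow> 'a set \<Rightarrow> 'a pair_pre_digraph" where
  "induced T W = \<lparr>pverts = W, parcs = {(u, v) \<in> parcs T. u \<in> W \<and> v \<in> W}\<rparr>"

lemma with_proj_induced: "with_proj (induced T W) = with_proj T \<restriction> W"
  by (auto simp: with_proj_def induced_def induce_subgraph_def)

lemma tournament_induced:
  assumes "tournament T" "W \<subseteq> pverts T"
  shows "tournament (induced T W)"
proof -
  interpret tournament T by fact
  have no_loop: "(u, u) \<notin> parcs T" for u
    using pair_no_loops[of "(u, u)"] by auto
  show ?thesis
  proof (rule tournamentI)
    show "finite (pverts (induced T W))"
      using assms(2) pair_finite_verts by (simp add: induced_def finite_subset)
    show "((u, v) \<in> parcs (induced T W)) \<noteq> ((v, u) \<in> parcs (induced T W))"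
      if "u \<in> pverts (induced T W)" "v \<in> pverts (induced T W)" "u \<noteq> v" for u v
      using one_arc[of u v] that assms(2) by (auto simp: induced_def)
  qed (use no_loop in \<open>auto simp: induced_def\<close>)
qed

definition transitive_tournament :: "'a pair_pre_digraph \<Rightarrow> bool" where
  "transitive_tournament T \<longleftrightarrow> tournament T \<and>
     \<not> (\<exists>u v w. (u, v) \<in> parcs T \<and> (v, w) \<in> parcs T \<and> (w, u) \<in> parcs T)"

text \<open>The list \<open>vs\<close> is the labelling \<open>v\<^sub>1, \<dots>, v\<^sub>n\<close> of the vertices.\<close>

definition skew_adjacency_mat :: "'a pair_pre_digraph \<Rightarrow> 'a list \<Rightarrow> int mat" where
  "skew_adjacency_mat T vs = mat (length vs) (length vs) (\<lambda>(i, j).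
     if (vs ! i, vs ! j) \<in> parcs T then 1
     else if (vs ! j, vs ! i) \<in> parcs T then -1
     else 0)"

text \<open>The chosen labelling is irrelevant, see \<open>tdet_eq\<close>.\<close>

definition tdet :: "'a pair_pre_digraph \<Rightarrow> int" where
  "tdet T = det (skew_adjacency_mat T (SOME vs. distinct vs \<and> set vs = pverts T))"

lemma det_skew_adjacency_mat_cong:
  assumes "distinct vs" "distinct ws" "set vs = set ws"
  shows "det (skew_adjacency_mat T vs) = det (skew_adjacency_mat T ws)"
proof -
  define n where "n = length vs"
  have len: "length ws = n"
    using assms by (metis n_def distinct_card)
  have "mset vs = mset ws"
    using assms by (simp add: set_eq_iff_mset_eq_distinct)
  then obtain p where p: "p permutes {..<n}" and vs: "permute_list p ws = vs"
    using mset_eq_permutation[of vs ws] len by auto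
  have p0: "p permutes {0..<n}" using p by (simp add: atLeast0LessThan)
  have nth: "vs ! i = ws ! p i" and lt: "p i < n" if "i < n" for i
    using permute_list_nth[of p ws i] vs p len that permutes_in_image[OF p, of i] by auto
  let ?A = "skew_adjacency_mat T ws"
  let ?B = "mat n n (\<lambda>(i, j). ?A $$ (i, p j))"
  have A: "?A \<in> carrier_mat n n" by (simp add: skew_adjacency_mat_def len)
  have B: "?B \<in> carrier_mat n n" by simp
  have AT: "transpose_mat ?A \<in> carrier_mat n n" using A by simp
  have "skew_adjacency_mat T vs = mat n n (\<lambda>(i, j). ?B $$ (p i, j))"
    by (rule eq_matI) (auto simp: skew_adjacency_mat_def len nth lt simp flip: n_def)
  then have "det (skew_adjacency_mat T vs) = signof p * det ?B"
    using det_permute_rows[OF B p0] by simp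
  also have "det ?B = det (transpose_mat ?B)"
    using det_transpose[OF B] by simp
  also have "transpose_mat ?B = mat n n (\<lambda>(i, j). transpose_mat ?A $$ (p i, j))"
    using A by (intro eq_matI) (auto simp: lt)
  also have "det \<dots> = signof p * det (transpose_mat ?A)"
    using det_permute_rows[OF AT p0] by simp
  also have "det (transpose_mat ?A) = det ?A"
    using det_transpose[OF A] .
  finally show ?thesis
    by (simp add: sign_def)
qed

lemma tdet_eq:
  assumes "distinct vs" "set vs = pverts T"
  shows "tdet T = det (skew_adjacency_mat T vs)"
proof -
  let ?ws = "SOME ws. distinct ws \<and> set ws = pverts T"
  have "distinct ?ws \<and> set ?ws = pverts T"
    by (rule someI[of _ vs]) (use assms in simp)
  then show ?thesis
    unfolding tdet_def using assms by (intro det_skew_adjacency_mat_cong) auto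
qed

definition tournaments_D :: "nat \<Rightarrow> 'a pair_pre_digraph set" where
  "tournaments_D k = {T. tournament T \<and>
     (\<forall>W \<subseteq> pverts T. W \<noteq> {} \<longrightarrow> tdet (induced T W) \<le> (int k)\<^sup>2)}"

definition switch :: "'a pair_pre_digraph \<Rightarrow> 'a set \<Rightarrow> 'a pair_pre_digraph" where
  "switch T W = \<lparr>pverts = pverts T, parcs =
     {(u, v). if (u \<in> W) = (v \<in> W) then (u, v) \<in> parcs T else (v, u) \<in> parcs T}\<rparr>"

definition switching_equivalent :: "'a pair_pre_digraph \<Rightarrow> 'a pair_pre_digraph \<Rightarrow> bool" where
  "switching_equivalent T T' \<longleftrightarrow> (\<exists>W \<subseteq> pverts T. T' = switch T W)"

text \<open>
  The block \<open>P i\<close> replaces the vertex \<open>i\<close> of \<open>R\<close>. Blowups are described up to isomorphism: the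
  vertices of the blocks are arbitrary elements of the type \<open>'a\<close>.
\<close>

definition is_transitive_blowup ::
    "'a pair_pre_digraph \<Rightarrow> 'b pair_pre_digraph \<Rightarrow> ('b \<Rightarrow> nat) \<Rightarrow> bool" where
  "is_transitive_blowup B R a \<longleftrightarrow> tournament B \<and> (\<exists>P.
     disjoint_family_on P (pverts R) \<and> pverts B = (\<Union>i\<in>pverts R. P i) \<and>
     (\<forall>i\<in>pverts R. card (P i) = a i \<and> transitive_tournament (induced B (P i))) \<and>
     (\<forall>i j. (i, j) \<in> parcs R \<longrightarrow> (\<forall>x\<in>P i. \<forall>y\<in>P j. (x, y) \<in> parcs B)))"

definition switching_equivalent_to_blowup_of ::
    "'a pair_pre_digraph \<Rightarrow> 'b pair_pre_digraph \<Rightarrow> bool" where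
  "switching_equivalent_to_blowup_of T R \<longleftrightarrow>
     (\<exists>a B. (\<forall>i\<in>pverts R. 0 < a i) \<and> is_transitive_blowup B R a \<and> switching_equivalent T B)"

definition Ltour :: "nat \<Rightarrow> nat pair_pre_digraph" where
  "Ltour m = \<lparr>pverts = {1..m}, parcs =
     {(i, j). 1 \<le> i \<and> i < j \<and> j \<le> m - 1} \<union>
     {(m, i) |i. 1 \<le> i \<and> i \<le> m - 1 \<and> odd i} \<union>
     {(i, m) |i. 1 \<le> i \<and> i \<le> m - 1 \<and> even i}\<rparr>"

lemma tournament_switch:
  assumes "tournament T"
  shows "tournament (switch T W)"
proof -
  interpret tournament T by fact
  have no_loop: "(u, u) \<notin> parcs T" for u
    using pair_no_loops[of "(u, u)"] by auto
  have arc: "(u, v) \<in> parcs (switch T W) \<longleftrightarrow>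
      (if (u \<in> W) = (v \<in> W) then (u, v) \<in> parcs T else (v, u) \<in> parcs T)" for u v
    by (simp add: switch_def)
  show ?thesis
  proof (rule tournamentI)
    show "finite (pverts (switch T W))"
      using pair_finite_verts by (simp add: switch_def)
    show "parcs (switch T W) \<subseteq> pverts (switch T W) \<times> pverts (switch T W)"
    proof (rule subrelI)
      fix u v assume "(u, v) \<in> parcs (switch T W)"
      then have "(u, v) \<in> parcs T \<or> (v, u) \<in> parcs T"
        unfolding arc by presburger
      then have "u \<in> pverts T \<and> v \<in> pverts T"
        using in_arcsD1 in_arcsD2 by blast
      then show "(u, v) \<in> pverts (switch T W) \<times> pverts (switch T W)"
        by (simp add: switch_def)
    qed
    show "(u, u) \<notin> parcs (switch T W)" for u
      unfolding arc using no_loop by simp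
    show "((u, v) \<in> parcs (switch T W)) \<noteq> ((v, u) \<in> parcs (switch T W))"
      if "u \<in> pverts (switch T W)" "v \<in> pverts (switch T W)" "u \<noteq> v" for u v
    proof -
      have "u \<in> pverts T" "v \<in> pverts T"
        using that by (simp_all add: switch_def)
      from one_arc[OF this that(3)] show ?thesis
        unfolding arc by argo
    qed
  qed
qed

lemma switching_equivalent_sym:
  assumes "switching_equivalent T T'"
  shows "switching_equivalent T' T"
proof -
  from assms obtain W where W: "W \<subseteq> pverts T" "T' = switch T W"
    unfolding switching_equivalent_def by blast
  have "T = switch (switch T W) W"
    by (cases T) (simp add: switch_def eq_commute cong: if_cong)
  moreover have "pverts T' = pverts T"
    using W(2) by (simp add: switch_def)
  ultimately show ?thesis
    unfolding switching_equivalent_def using W by metis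
qed

lemma tournament_Ltour: "tournament (Ltour m)"
proof (rule tournamentI)
  show "((u, v) \<in> parcs (Ltour m)) \<noteq> ((v, u) \<in> parcs (Ltour m))"
    if "u \<in> pverts (Ltour m)" "v \<in> pverts (Ltour m)" "u \<noteq> v" for u v
  proof (cases "u = m \<or> v = m")
    case True
    with that show ?thesis by (auto simp: Ltour_def)
  next
    case False
    with that show ?thesis by (auto simp: Ltour_def)
  qed
  show "finite (pverts (Ltour m))"
    by (simp add: Ltour_def)
  show "parcs (Ltour m) \<subseteq> pverts (Ltour m) \<times> pverts (Ltour m)"
    by (rule subrelI) (auto simp: Ltour_def)
  show "(u, u) \<notin> parcs (Ltour m)" for u
    by (auto simp: Ltour_def)
qed

end

theory Submission
  imports Defs
begin

text \<open>
  Up to switching, a tournament is a skew-symmetric sign matrix, and a principal minor is the square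
  of a Pfaffian. Eliminating a unit pivot shows that deleting two consecutive vertices of a
  transitive block (twins) preserves the determinant, so minors of a blowup of \<open>L\<^sub>m\<close> reduce to minors
  of \<open>L\<^sub>m\<close> itself.

  Conversely, a tournament that is not switching equivalent to a transitive one contains \<open>L\<^sub>4\<close>.
  Let \<open>R\<close> be a copy of \<open>L\<^sub>4\<close> or \<open>L\<^sub>6\<close> in a tournament of \<open>\<D>\<^sub>5\<close>. Every vertex sees
  \<open>R\<close> like one of the vertices of \<open>R\<close>: for \<open>L\<^sub>4\<close> this is automatic, for \<open>L\<^sub>6\<close> all other sign
  vectors create a Pfaffian of modulus at least 7 on six vertices. A 3-cycle among vertices of
  one type multiplies the determinant of \<open>R\<close> by 9. If \<open>x\<close>, \<open>y\<close> look like \<open>u \<noteq> v\<close> but the arc between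
  \<open>x\<close> and \<open>y\<close> is wrong, then the Pfaffian of \<open>R\<close> together with \<open>x\<close>, \<open>y\<close> is
  \<open>\<plusminus>Pf(R - u - v) \<plusminus> 2 Pf(R)\<close>: for \<open>L\<^sub>6\<close> its modulus is at least 7, and for \<open>L\<^sub>4\<close> it is 5 or 7,
  where 5 forces a copy of \<open>L\<^sub>6\<close>.
\<close>

section \<open>Determinants of skew-symmetric matrices indexed by lists\<close>

text \<open>Principal minors are indexed by lists, so that chosen vertices can be put in front and
  eliminated; by \<open>sdet_perm\<close> the order is irrelevant.\<close>

definition sdet :: "('a \<Rightarrow> 'a \<Rightarrow> int) \<Rightarrow> 'a list \<Rightarrow> int" where
  "sdet f vs = det (mat (length vs) (length vs) (\<lambda>(i, j). f (vs ! i) (vs ! j)))"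

lemma sdet_cong:
  assumes "\<And>x y. x \<in> set vs \<Longrightarrow> y \<in> set vs \<Longrightarrow> f x y = g x y"
  shows "sdet f vs = sdet g vs"
proof -
  have "mat (length vs) (length vs) (\<lambda>(i, j). f (vs ! i) (vs ! j)) =
    mat (length vs) (length vs) (\<lambda>(i, j). g (vs ! i) (vs ! j))"
    by (rule eq_matI) (auto intro: assms)
  then show ?thesis by (simp add: sdet_def)
qed

lemma sdet_map: "sdet f (map e vs) = sdet (\<lambda>i j. f (e i) (e j)) vs"
proof -
  have "mat (length vs) (length vs) (\<lambda>(i, j). f (map e vs ! i) (map e vs ! j)) =
    mat (length vs) (length vs) (\<lambda>(i, j). f (e (vs ! i)) (e (vs ! j)))"
    by (rule eq_matI) auto
  then show ?thesis by (simp add: sdet_def)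
qed

lemma sdet_Nil [simp]: "sdet f [] = 1"
  by (simp add: sdet_def)

text \<open>Every Leibniz term takes each row and each column once, so each factor \<open>e\<close>
  enters twice. Signs \<open>e\<close> express switching; the value 3 occurs in
  \<open>sdet_cyclic_triple\<close>.\<close>

lemma sdet_scale:
  "sdet (\<lambda>x y. e x * e y * f x y) vs = (prod_list (map e vs))\<^sup>2 * sdet f vs"
proof -
  let ?n = "length vs"
  have p: "(\<Prod>i = 0..<?n. e (vs ! i) * e (vs ! p i) * f (vs ! i) (vs ! p i)) =
      (prod_list (map e vs))\<^sup>2 * (\<Prod>i = 0..<?n. f (vs ! i) (vs ! p i))"
    if "p permutes {0..<?n}" for p
  proof -
    have "(\<Prod>i = 0..<?n. e (vs ! p i)) = (\<Prod>i = 0..<?n. e (vs ! i))"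
      using prod.permute[OF that, of "\<lambda>i. e (vs ! i)"] by (simp add: o_def)
    moreover have "prod_list (map e vs) = (\<Prod>i = 0..<?n. e (vs ! i))"
      by (simp add: prod.list_conv_set_nth)
    ultimately show ?thesis
      by (simp add: prod.distrib power2_eq_square)
  qed
  have in_range: "p i < ?n" if "p permutes {0..<?n}" "i < ?n" for p i
    using permutes_in_image[OF that(1), of i] that(2) by simp
  show ?thesis
    unfolding sdet_def
    by (subst (1 2) det_def'[of _ ?n])
      (auto simp: sum_distrib_left p in_range intro!: sum.cong)
qed

text \<open>Rows and columns are permuted together, so the sign of the permutation occurs twice and
  cancels.\<close>

lemma sdet_perm:
  assumes "mset vs = mset ws"
  shows "sdet f vs = sdet f ws"
proof -
  define n where "n = length ws"
  have len: "length vs = n"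
    using assms by (metis n_def size_mset)
  obtain p where p: "p permutes {..<n}" and vs: "permute_list p ws = vs"
    using mset_eq_permutation[OF assms] n_def by auto
  have p0: "p permutes {0..<n}" using p by (simp add: atLeast0LessThan)
  have nth: "vs ! i = ws ! p i" and lt: "p i < n" if "i < n" for i
    using permute_list_nth[of p ws i] vs p that permutes_in_image[OF p, of i] by (auto simp: n_def)
  define A where "A = mat n n (\<lambda>(i, j). f (ws ! i) (ws ! j))"
  define B where "B = mat n n (\<lambda>(i, j). f (ws ! i) (ws ! p j))"
  have A: "transpose_mat A \<in> carrier_mat n n" "A \<in> carrier_mat n n" 
    and B: "B \<in> carrier_mat n n" by (simp_all add: A_def B_def)
  have "sdet f vs = det (mat n n (\<lambda>(i, j). B $$ (p i, j)))"
    unfolding sdet_def by (rule arg_cong[where f = det], rule eq_matI) (auto simp: B_def len nth lt)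
  also have "\<dots> = signof p * det (transpose_mat B)"
    using det_permute_rows[OF B p0] det_transpose[OF B] by simp
  also have "transpose_mat B = mat n n (\<lambda>(i, j). transpose_mat A $$ (p i, j))"
    by (rule eq_matI) (auto simp: A_def B_def lt)
  also have "det \<dots> = signof p * det A"
    using det_permute_rows[OF A(1) p0] det_transpose[OF A(2)] by simp
  also have "det A = sdet f ws"
    by (simp add: sdet_def A_def n_def)
  finally show ?thesis
    by (simp add: sign_def)
qed

lemma sdet_distinct_cong:
  assumes "distinct vs" "distinct ws" "set vs = set ws"
  shows "sdet f vs = sdet f ws"
  using assms by (intro sdet_perm) (simp add: set_eq_iff_mset_eq_distinct)

definition skew :: "('a \<Rightarrow> 'a \<Rightarrow> int) \<Rightarrow> bool" where
  "skew f \<longleftrightarrow> (\<forall>x y. f y x = - f x y)"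

lemma skewD: "skew f \<Longrightarrow> f y x = - f x y"
  unfolding skew_def by blast

lemma skew_self: "skew f \<Longrightarrow> f x x = 0"
  using skewD[of f x x] by simp

lemma skew_scale: "skew f \<Longrightarrow> skew (\<lambda>x y. e x * e y * f x y)"
  unfolding skew_def by (metis mult.commute mult_minus_right)

text \<open>Transposition negates the matrix, which multiplies the determinant by -1 in odd
  dimension.\<close>

lemma sdet_odd:
  assumes "skew f" "odd (length vs)"
  shows "sdet f vs = 0"
proof -
  let ?A = "mat (length vs) (length vs) (\<lambda>(i, j). f (vs ! i) (vs ! j))"
  have "transpose_mat ?A = (-1) \<cdot>\<^sub>m ?A"
    by (rule eq_matI) (auto intro: skewD[OF assms(1)])
  moreover have "det (transpose_mat ?A) = det ?A"
    by (rule det_transpose[of _ "length vs"]) simp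
  ultimately have "det ?A = - det ?A"
    using assms(2) by simp
  then show ?thesis by (simp add: sdet_def)
qed

section \<open>Minors, elimination of a unit pivot, and Pfaffians\<close>

definition minor :: "('a \<Rightarrow> 'a \<Rightarrow> int) \<Rightarrow> 'a list \<Rightarrow> 'a list \<Rightarrow> int" where
  "minor f rs cs = det (mat (length cs) (length cs) (\<lambda>(i, j). f (rs ! i) (cs ! j)))"

lemma minor_Nil: "minor f rs [] = 1"
  by (simp add: minor_def)

lemma minor_Cons:
  assumes "length rs = Suc (length cs)"
  shows "minor f rs (c # cs) =
    (\<Sum>i<Suc (length cs). f (rs ! i) c * ((-1) ^ i * minor f (take i rs @ drop (Suc i) rs) cs))"
proof -
  let ?n = "length cs"
  let ?A = "mat (Suc ?n) (Suc ?n) (\<lambda>(i, j). f (rs ! i) ((c # cs) ! j))"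
  have "mat_delete ?A i 0 = mat ?n ?n (\<lambda>(k, l). f ((take i rs @ drop (Suc i) rs) ! k) (cs ! l))"
    if "i < Suc ?n" for i
    using that assms by (intro eq_matI) (auto simp: mat_delete_def nth_append)
  then show ?thesis
    unfolding minor_def
    by (subst laplace_expansion_column[of _ "Suc ?n" 0]) (auto simp: cofactor_def)
qed

lemma sdet_eq_minor: "sdet f vs = minor f vs vs"
  by (simp add: sdet_def minor_def)

lemma minor_2: "minor f [x, y] [a, b] = f x a * f y b - f y a * f x b"
  by (simp add: minor_Cons minor_Nil)

lemma minor_3:
  "minor f [x, y, z] [a, b, c] = f x a * (f y b * f z c - f z b * f y c)
    - f y a * (f x b * f z c - f z b * f x c) + f z a * (f x b * f y c - f y b * f x c)"
  by (subst minor_Cons) (simp_all add: minor_2 right_diff_distrib)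

lemma sdet_2:
  assumes "skew f"
  shows "sdet f [a, b] = (f a b)\<^sup>2"
  using skewD[OF assms, of b a]
  by (simp add: sdet_eq_minor minor_2 skew_self[OF assms] power2_eq_square)

text \<open>Schur complement of the block \<open>{a, b}\<close>, using that \<open>f a b\<close> is its own inverse.\<close>

definition pivot :: "('a \<Rightarrow> 'a \<Rightarrow> int) \<Rightarrow> 'a \<Rightarrow> 'a \<Rightarrow> 'a \<Rightarrow> 'a \<Rightarrow> int" where
  "pivot f a b x y = f x y + f a b * (f x a * f b y - f x b * f a y)"

lemma skew_pivot:
  assumes "skew f"
  shows "skew (pivot f a b)"
  unfolding skew_def pivot_def
proof (intro allI)
  fix x y
  have "f y x = - f x y" "f y a = - f a y" "f b x = - f x b" "f y b = - f b y" "f a x = - f x a"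
    using assms by (rule skewD)+
  then show "f y x + f a b * (f y a * f b x - f y b * f a x) =
      - (f x y + f a b * (f x a * f b y - f x b * f a y))"
    by (simp add: algebra_simps)
qed

text \<open>Block elimination: the matrix is a unipotent block matrix times a block triangular one
  whose diagonal blocks are \<open>A\<close>, of determinant \<open>f a b * f a b = 1\<close>, and
  the Schur complement \<open>E\<close>.\<close>

lemma sdet_pivot:
  assumes skew: "skew f" and unit: "f a b \<in> {1, -1}"
  shows "sdet f (a # b # vs) = sdet (pivot f a b) vs"
proof -
  let ?n = "length vs"
  let ?c = "f a b"
  have cc: "?c * ?c = 1" and ccx: "?c * (?c * x) = x" for x
    using unit by auto
  have diag: "f x x = 0" for x
    by (rule skew_self[OF skew])
  have ba: "f b a = - ?c" by (rule skewD[OF skew])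
  define A where "A = mat 2 2 (\<lambda>(i, j). f ([a, b] ! i) ([a, b] ! j))"
  define B where "B = mat 2 ?n (\<lambda>(i, j). f ([a, b] ! i) (vs ! j))"
  define C where "C = mat ?n 2 (\<lambda>(i, j). f (vs ! i) ([a, b] ! j))"
  define D where "D = mat ?n ?n (\<lambda>(i, j). f (vs ! i) (vs ! j))"
  \<comment> \<open>\<open>X\<close> is \<open>C\<close> times the inverse of \<open>A\<close>; as
    \<open>f a b\<close> is its own inverse, the entries stay integral.\<close>
  define X where "X = mat ?n 2 (\<lambda>(i, j). if j = 0 then ?c * f (vs ! i) b else - ?c * f (vs ! i) a)"
  define E where "E = mat ?n ?n (\<lambda>(i, j). pivot f a b (vs ! i) (vs ! j))"
  have carr: "A \<in> carrier_mat 2 2" "B \<in> carrier_mat 2 ?n" "C \<in> carrier_mat ?n 2"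
    "D \<in> carrier_mat ?n ?n" "X \<in> carrier_mat ?n 2" "E \<in> carrier_mat ?n ?n"
    by (simp_all add: A_def B_def C_def D_def X_def E_def)
  have XA: "X * A = C"
    by (rule eq_matI)
      (auto simp: X_def A_def C_def scalar_prod_def numeral_2_eq_2 less_Suc_eq diag ba
        algebra_simps ccx)
  have XBE: "X * B + E = D"
    by (rule eq_matI)
      (auto simp: X_def B_def D_def E_def pivot_def scalar_prod_def numeral_2_eq_2 algebra_simps)
  have "mat (length (a # b # vs)) (length (a # b # vs))
      (\<lambda>(i, j). f ((a # b # vs) ! i) ((a # b # vs) ! j)) = four_block_mat A B C D"
    by (rule eq_matI)
      (auto simp: A_def B_def C_def D_def nth_Cons' numeral_2_eq_2)
  also have "\<dots> = four_block_mat (1\<^sub>m 2) (0\<^sub>m 2 ?n) X (1\<^sub>m ?n) *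
      four_block_mat A B (0\<^sub>m ?n 2) E"
    using carr XA XBE
    by (subst mult_four_block_mat[where ?nr1.0 = 2 and ?n1.0 = 2 and ?n2.0 = ?n and ?nr2.0 = ?n
          and ?nc1.0 = 2 and ?nc2.0 = ?n]) auto
  finally have "sdet f (a # b # vs) = det (four_block_mat (1\<^sub>m 2) (0\<^sub>m 2 ?n) X (1\<^sub>m ?n)) *
      det (four_block_mat A B (0\<^sub>m ?n 2) E)"
    unfolding sdet_def using carr
    by (simp only:) (rule det_mult[where n = "2 + ?n"]; intro four_block_carrier_mat; simp)
  moreover have "det (four_block_mat (1\<^sub>m 2) (0\<^sub>m 2 ?n) X (1\<^sub>m ?n)) = 1"
    using det_four_block_mat_upper_right_zero[OF _ refl carr(5), of "1\<^sub>m 2" "1\<^sub>m ?n"] by simp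
  moreover have "det (four_block_mat A B (0\<^sub>m ?n 2) E) = det A * det E"
    using det_four_block_mat_lower_left_zero[OF carr(1,2) refl carr(6)] .
  moreover have "det A = 1"
    using sdet_2[OF skew, of a b] unfolding sdet_def A_def by (simp add: numeral_2_eq_2 cc power2_eq_square)
  ultimately show ?thesis
    by (simp add: sdet_def E_def)
qed

text \<open>Pfaffians on four and, next, on six vertices, expanded along the first vertex.\<close>

definition pf4 :: "('a \<Rightarrow> 'a \<Rightarrow> int) \<Rightarrow> 'a \<Rightarrow> 'a \<Rightarrow> 'a \<Rightarrow> 'a \<Rightarrow> int" where
  "pf4 f a b c d = f a b * f c d - f a c * f b d + f a d * f b c"

definition pf6 :: "('a \<Rightarrow> 'a \<Rightarrow> int) \<Rightarrow> 'a \<Rightarrow> 'a \<Rightarrow> 'a \<Rightarrow> 'a \<Rightarrow> 'a \<Rightarrow> 'a \<Rightarrow> int" where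
  "pf6 f a b c d e g = f a b * pf4 f c d e g - f a c * pf4 f b d e g + f a d * pf4 f b c e g
     - f a e * pf4 f b c d g + f a g * pf4 f b c d e"

lemma sdet_4:
  assumes "skew f"
  shows "sdet f [a, b, c, d] = (pf4 f a b c d)\<^sup>2"
proof -
  have rev: "f b a = - f a b" "f c a = - f a c" "f d a = - f a d"
    "f c b = - f b c" "f d b = - f b d" "f d c = - f c d"
    using assms by (rule skewD)+
  have "sdet f [a, b, c, d] = f a a * minor f [b, c, d] [b, c, d] - f b a * minor f [a, c, d] [b, c, d]
     + f c a * minor f [a, b, d] [b, c, d] - f d a * minor f [a, b, c] [b, c, d]"
    unfolding sdet_eq_minor by (subst minor_Cons) simp_all
  also have "\<dots> = (f a b * f c d - f a c * f b d + f a d * f b c)\<^sup>2"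
    unfolding minor_3 rev skew_self[OF assms] power2_eq_square by (simp add: algebra_simps)
  finally show ?thesis by (simp only: pf4_def)
qed

text \<open>Pivoting on \<open>a\<close>, \<open>b\<close> leaves a determinant of size four. The
  Pfaffian of the Schur complement is \<open>pf6\<close> times the unit \<open>f a b\<close>, which
  disappears in the square.\<close>

lemma sdet_6:
  assumes "skew f" and unit: "f a b \<in> {1, -1}"
  shows "sdet f [a, b, c, d, e, g] = (pf6 f a b c d e g)\<^sup>2"
proof -
  have rev: "f x a = - f a x" "f x b = - f b x" for x
    using assms(1) by (rule skewD)+
  have "sdet f [a, b, c, d, e, g] = (pf4 (pivot f a b) c d e g)\<^sup>2"
    by (simp only: sdet_pivot[OF assms] sdet_4[OF skew_pivot[OF assms(1)]])
  also have "pf4 (pivot f a b) c d e g = f a b * pf6 f a b c d e g"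
  proof -
    from unit consider "f a b = 1" | "f a b = -1" by auto
    then show ?thesis
      by cases (simp_all add: pf4_def pf6_def pivot_def rev[of c] rev[of d] rev[of e] rev[of g]
          algebra_simps)
  qed
  also have "\<dots>\<^sup>2 = (pf6 f a b c d e g)\<^sup>2"
    using unit by auto
  finally show ?thesis .
qed

text \<open>The two correction terms of \<open>pivot f a b\<close> cancel, so the Schur complement
  on \<open>vs\<close> is the original matrix.\<close>

lemma sdet_twins:
  assumes "skew f" "f a b \<in> {1, -1}" "\<And>x. x \<in> set vs \<Longrightarrow> f a x = f b x"
  shows "sdet f (a # b # vs) = sdet f vs"
proof -
  have "f x a = f x b" if "x \<in> set vs" for x
    using assms(3)[OF that] skewD[OF assms(1), of x a] skewD[OF assms(1), of x b] by simp
  then have "sdet (pivot f a b) vs = sdet f vs"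
    by (intro sdet_cong) (simp add: pivot_def assms(3))
  then show ?thesis
    by (simp only: sdet_pivot[OF assms(1,2)])
qed

text \<open>Pivoting on \<open>a\<close>, \<open>b\<close> leaves the entries among
  \<open>vs\<close> alone and adds two more copies of \<open>f x c\<close> to the entry at
  \<open>x\<close>, \<open>c\<close>. The row and the column of \<open>c\<close> are thus
  tripled.\<close>

lemma sdet_cyclic_triple:
  assumes "skew f" "f a b = 1" "f b c = 1" "f c a = 1" "distinct (c # vs)"
    and twins: "\<And>x. x \<in> set vs \<Longrightarrow> f a x = f c x" "\<And>x. x \<in> set vs \<Longrightarrow> f b x = f c x"
  shows "sdet f (a # b # c # vs) = 9 * sdet f (c # vs)"
proof -
  let ?e = "\<lambda>x. if x = c then 3 else 1 :: int"
  note rev = skewD[OF assms(1)]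
  have tw: "f x a = f x c" "f x b = f x c" if "x \<in> set vs" for x
    using twins[OF that] rev[of x a] rev[of x b] rev[of x c] by simp_all
  have cb: "f c b = -1" "f a c = -1" using rev[of b c] rev[of c a] assms by simp_all
  have eq: "pivot f a b x y = ?e x * ?e y * f x y" if "x \<in> set (c # vs)" "y \<in> set (c # vs)" for x y
  proof -
    have "f c c = 0" by (rule skew_self[OF assms(1)])
    with assms(2-5) cb have "pivot f a b c c = 0"
      "x \<in> set vs \<Longrightarrow> pivot f a b x c = 3 * f x c" "y \<in> set vs \<Longrightarrow> pivot f a b c y = 3 * f c y"
      "x \<in> set vs \<Longrightarrow> y \<in> set vs \<Longrightarrow> pivot f a b x y = f x y"
      unfolding pivot_def by (simp_all add: twins[of y] tw[of x])
    with that assms(5) \<open>f c c = 0\<close> show ?thesis by auto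
  qed
  have "sdet f (a # b # c # vs) = sdet (pivot f a b) (c # vs)"
    by (rule sdet_pivot[OF assms(1)]) (use assms in simp)
  also have "\<dots> = (prod_list (map ?e (c # vs)))\<^sup>2 * sdet f (c # vs)"
    unfolding sdet_scale[symmetric] by (rule sdet_cong) (rule eq)
  also have "map ?e vs = map (\<lambda>x. 1) vs"
    using assms(5) by (intro map_cong) auto
  then have "prod_list (map ?e (c # vs)) = 3"
    by (simp add: map_replicate_const)
  finally show ?thesis by simp
qed

section \<open>Sign matrices of tournaments\<close>

definition sg :: "'a pair_pre_digraph \<Rightarrow> 'a \<Rightarrow> 'a \<Rightarrow> int" where
  "sg T u v = (if (u, v) \<in> parcs T then 1 else if (v, u) \<in> parcs T then -1 else 0)"

lemma tournament_asym: "tournament T \<Longrightarrow> (u, v) \<in> parcs T \<Longrightarrow> (v, u) \<notin> parcs T"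
proof -
  assume "tournament T" and uv: "(u, v) \<in> parcs T"
  then interpret tournament T by simp
  have "u \<in> pverts T" "v \<in> pverts T"
    using uv in_arcsD1 in_arcsD2 by auto
  moreover have "u \<noteq> v" using pair_no_loops[OF uv] by simp
  ultimately show ?thesis using one_arc uv by blast
qed

lemma skew_sg: "tournament T \<Longrightarrow> skew (sg T)"
  using tournament_asym[of T] unfolding skew_def sg_def by auto

lemma sg_unit:
  "tournament T \<Longrightarrow> u \<in> pverts T \<Longrightarrow> v \<in> pverts T \<Longrightarrow> u \<noteq> v \<Longrightarrow> sg T u v \<in> {1, -1}"
  using tournament.one_arc[of T u v] by (auto simp: sg_def)

lemma sg_eq_1_iff: "sg T u v = 1 \<longleftrightarrow> (u, v) \<in> parcs T"
  by (simp add: sg_def)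

lemma tdet_induced:
  assumes "distinct vs"
  shows "tdet (induced T (set vs)) = sdet (sg T) vs"
proof -
  have "skew_adjacency_mat (induced T (set vs)) vs =
      mat (length vs) (length vs) (\<lambda>(i, j). sg T (vs ! i) (vs ! j))"
    by (rule eq_matI) (auto simp: skew_adjacency_mat_def sg_def induced_def)
  then show ?thesis
    using tdet_eq[of vs "induced T (set vs)"] assms by (simp add: sdet_def induced_def)
qed

definition sdet_bounded :: "'a set \<Rightarrow> ('a \<Rightarrow> 'a \<Rightarrow> int) \<Rightarrow> int \<Rightarrow> bool" where
  "sdet_bounded V f c \<longleftrightarrow> (\<forall>vs. distinct vs \<longrightarrow> set vs \<subseteq> V \<longrightarrow> sdet f vs \<le> c)"

lemma tournaments_D_iff:
  assumes "tournament T" "k > 0"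
  shows "T \<in> tournaments_D k \<longleftrightarrow> sdet_bounded (pverts T) (sg T) ((int k)\<^sup>2)"
proof
  assume T: "T \<in> tournaments_D k"
  show "sdet_bounded (pverts T) (sg T) ((int k)\<^sup>2)"
    unfolding sdet_bounded_def
  proof (intro allI impI)
    fix vs assume vs: "distinct vs" "set vs \<subseteq> pverts T"
    show "sdet (sg T) vs \<le> (int k)\<^sup>2"
    proof (cases "vs = []")
      case False
      then have "tdet (induced T (set vs)) \<le> (int k)\<^sup>2"
        using T vs(2) unfolding tournaments_D_def by blast
      then show ?thesis
        by (simp only: tdet_induced[OF vs(1)])
    \<comment> \<open>The empty list is no subtournament; its determinant 1 respects the bound
      because \<open>k\<close> is positive.\<close>
    qed (use assms(2) in simp)
  qed
next
  assume bd: "sdet_bounded (pverts T) (sg T) ((int k)\<^sup>2)"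
  have "tdet (induced T W) \<le> (int k)\<^sup>2" if W: "W \<subseteq> pverts T" for W
  proof -
    have "finite W"
      using W assms(1) by (meson finite_subset pair_fin_digraph.pair_finite_verts
          pair_digraph.axioms tournament.axioms(1))
    then obtain vs where "distinct vs" "set vs = W"
      using finite_distinct_list by blast
    then show ?thesis
      using bd W tdet_induced[of vs T] by (auto simp: sdet_bounded_def)
  qed
  then show "T \<in> tournaments_D k"
    using assms(1) by (simp add: tournaments_D_def)
qed

text \<open>Switching is conjugation by a diagonal sign matrix and so preserves all principal
  minors, by \<open>sdet_sign_change\<close>.\<close>

lemma sg_switch:
  "sg (switch T W) x y = (if x \<in> W then -1 else 1) * (if y \<in> W then -1 else 1) * sg T x y"
  if "tournament T"
  using tournament_asym[OF that] by (auto simp: sg_def switch_def)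

lemma sdet_sign_change:
  assumes "\<And>x. x \<in> set vs \<Longrightarrow> d x \<in> {1, -1 :: int}"
  shows "sdet (\<lambda>x y. d x * d y * f x y) vs = sdet f vs"
proof -
  have "(prod_list (map d vs))\<^sup>2 = 1"
    using assms by (induction vs) (force simp: power_mult_distrib)+
  then show ?thesis by (simp add: sdet_scale)
qed

lemma sg_Ltour:
  assumes "1 \<le> i" "i < j" "j \<le> m"
  shows "sg (Ltour m) i j = (if j < m \<or> even i then 1 else -1)"
  using assms by (auto simp: sg_def Ltour_def)

lemma Ltour_verts [simp]: "pverts (Ltour m) = {1..m}"
  by (simp add: Ltour_def)

lemma skew_Ltour: "skew (sg (Ltour m))"
  by (rule skew_sg[OF tournament_Ltour])

lemma interval_1_4: "{1..4::nat} = {1, 2, 3, 4}"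
  by (auto simp: numeral_eq_Suc le_Suc_eq)

lemma interval_1_6: "{1..6::nat} = {1, 2, 3, 4, 5, 6}"
  by (auto simp: numeral_eq_Suc le_Suc_eq)

text \<open>In the natural order of the vertices the Pfaffian is computed directly; its modulus is
  \<open>m - 1\<close>.\<close>

lemma sdet_Ltour:
  assumes "distinct vs" "set vs = {1..m}" "m \<in> {4, 6}"
  shows "sdet (sg (Ltour m)) vs = (int m - 1)\<^sup>2"
proof -
  consider "m = 4" | "m = 6" using assms(3) by blast
  then show ?thesis
  proof cases
    case 1
    have "set vs = set [1, 2, 3, 4]"
      unfolding assms(2) 1 interval_1_4 by simp
    then have "sdet (sg (Ltour 4)) vs = sdet (sg (Ltour 4)) [1, 2, 3, 4]"
      using assms(1) by (intro sdet_distinct_cong) auto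
    also have "\<dots> = (pf4 (sg (Ltour 4)) 1 2 3 4)\<^sup>2"
      by (rule sdet_4[OF skew_Ltour])
    finally show ?thesis using 1 by (simp add: pf4_def sg_Ltour)
  next
    case 2
    have "set vs = set [1, 2, 3, 4, 5, 6]"
      unfolding assms(2) 2 interval_1_6 by simp
    then have "sdet (sg (Ltour 6)) vs = sdet (sg (Ltour 6)) [1, 2, 3, 4, 5, 6]"
      using assms(1) by (intro sdet_distinct_cong) auto
    also have "\<dots> = (pf6 (sg (Ltour 6)) 1 2 3 4 5 6)\<^sup>2"
      by (rule sdet_6[OF skew_Ltour]) (simp add: sg_Ltour)
    finally show ?thesis using 2 by (simp add: pf6_def pf4_def sg_Ltour)
  qed
qed

text \<open>The vertices with \<open>d x = -1\<close> are switched and the fibres of \<tau> become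
  the blocks; absence of 3-cycles in a fibre is transitivity of its block.\<close>

lemma switching_blowupI:
  assumes T: "tournament T"
    and \<tau>: "\<And>x. x \<in> pverts T \<Longrightarrow> \<tau> x \<in> {1..m}"
    and surj: "\<And>i. i \<in> {1..m} \<Longrightarrow> \<exists>x\<in>pverts T. \<tau> x = i"
    and d: "\<And>x. x \<in> pverts T \<Longrightarrow> d x \<in> {1, -1 :: int}"
    and cross: "\<And>x y. x \<in> pverts T \<Longrightarrow> y \<in> pverts T \<Longrightarrow> \<tau> x \<noteq> \<tau> y \<Longrightarrow>
      d x * d y * sg T x y = sg (Ltour m) (\<tau> x) (\<tau> y)"
    and acyclic: "\<And>x y z. x \<in> pverts T \<Longrightarrow> y \<in> pverts T \<Longrightarrow> z \<in> pverts T \<Longrightarrow>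
      \<tau> x = \<tau> z \<Longrightarrow> \<tau> y = \<tau> z \<Longrightarrow> d x * d y * sg T x y = 1 \<Longrightarrow> d y * d z * sg T y z = 1 \<Longrightarrow>
      d z * d x * sg T z x = 1 \<Longrightarrow> False"
  shows "switching_equivalent_to_blowup_of T (Ltour m)"
proof -
  define W where "W = {x \<in> pverts T. d x = -1}"
  define B where "B = switch T W"
  define P where "P i = {x \<in> pverts T. \<tau> x = i}" for i
  have fin: "finite (pverts T)"
    using T by (meson pair_fin_digraph.pair_finite_verts pair_digraph.axioms tournament.axioms(1))
  have B: "tournament B" "pverts B = pverts T"
    unfolding B_def using tournament_switch[OF T] by (auto simp: switch_def)
  have arcs: "(x, y) \<in> parcs B \<longleftrightarrow> d x * d y * sg T x y = 1"
    if "x \<in> pverts T" "y \<in> pverts T" for x y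
    using d[OF that(1)] d[OF that(2)] that
    by (auto simp: B_def W_def sg_switch[OF T] simp flip: sg_eq_1_iff)
  have "tournament (induced B (P i))" for i
    by (rule tournament_induced[OF B(1)]) (auto simp: B P_def)
  then have "transitive_tournament (induced B (P i))" for i
    using acyclic by (auto simp: transitive_tournament_def P_def induced_def arcs)
  moreover have "(x, y) \<in> parcs B" if "(i, j) \<in> parcs (Ltour m)" "x \<in> P i" "y \<in> P j" for i j x y
  proof -
    have "i \<noteq> j" using tournament_asym[OF tournament_Ltour that(1)] that(1) by auto
    then show ?thesis
      using that cross[of x y] by (auto simp: P_def arcs sg_eq_1_iff)
  qed
  ultimately have "is_transitive_blowup B (Ltour m) (\<lambda>i. card (P i))"
    unfolding is_transitive_blowup_def
    using \<tau> B by (intro conjI exI[of _ P]) (auto simp: P_def disjoint_family_on_def)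
  moreover have "\<forall>i\<in>pverts (Ltour m). 0 < card (P i)"
    using surj fin by (fastforce simp: P_def card_gt_0_iff)
  moreover have "switching_equivalent T B"
    unfolding switching_equivalent_def B_def by (rule exI[of _ W]) (auto simp: W_def)
  ultimately show ?thesis
    unfolding switching_equivalent_to_blowup_of_def
    by (intro exI[of _ "\<lambda>i. card (P i)"] exI[of _ B] conjI)
qed

section \<open>Copies of \<open>L\<^sub>m\<close> up to switching\<close>

text \<open>The signs \<open>s\<close> encode a switching of the copy. They are required on all of
  \<open>nat\<close>, so witnesses carry the default 1 outside \<open>{1..m}\<close>.\<close>

definition contains_L :: "nat \<Rightarrow> 'a set \<Rightarrow> ('a \<Rightarrow> 'a \<Rightarrow> int) \<Rightarrow> bool" where
  "contains_L m V f \<longleftrightarrow> (\<exists>e s. inj_on e {1..m} \<and> e ` {1..m} \<subseteq> V \<and> (\<forall>i. s i \<in> {1, -1}) \<and>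
     (\<forall>i\<in>{1..m}. \<forall>j\<in>{1..m}. f (e i) (e j) = s i * s j * sg (Ltour m) i j))"

text \<open>By skew symmetry the pairs with \<open>i < j\<close> determine the rest. List positions
  start at 0 and the vertices of \<open>Ltour m\<close> at 1, hence the shifts by
  \<open>Suc\<close>.\<close>

lemma contains_L_listI:
  assumes "skew f" "length es = m" "length ss = m" "distinct es" "set es \<subseteq> V" "set ss \<subseteq> {1, -1}"
    and arcs: "\<And>i j. i < j \<Longrightarrow> j < m \<Longrightarrow>
      f (es ! i) (es ! j) = ss ! i * ss ! j * sg (Ltour m) (Suc i) (Suc j)"
  shows "contains_L m V f"
proof -
  let ?e = "\<lambda>i. es ! (i - 1)"
  let ?s = "\<lambda>i. if i \<in> {1..m} then ss ! (i - 1) else 1"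
  have lt: "f (?e i) (?e j) = ?s i * ?s j * sg (Ltour m) i j" if "1 \<le> i" "i < j" "j \<le> m" for i j
    using arcs[of "i - 1" "j - 1"] that by auto
  have "f (?e i) (?e j) = ?s i * ?s j * sg (Ltour m) i j" if "i \<in> {1..m}" "j \<in> {1..m}" for i j
  proof (cases i j rule: linorder_cases)
    case less
    then show ?thesis using that by (intro lt) auto
  next
    case equal
    then show ?thesis
      using skew_self[OF assms(1)] skew_self[OF skew_Ltour[of m]] by simp
  next
    case greater
    then have "f (?e j) (?e i) = ?s j * ?s i * sg (Ltour m) j i"
      using that by (intro lt) auto
    moreover have "f (?e i) (?e j) = - f (?e j) (?e i)"
      by (rule skewD[OF assms(1)])
    moreover have "sg (Ltour m) i j = - sg (Ltour m) j i"
      by (rule skewD[OF skew_Ltour])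
    ultimately show ?thesis by simp
  qed
  moreover have "inj_on ?e {1..m}"
    using assms(2,4) by (auto simp: inj_on_def nth_eq_iff_index_eq)
  moreover have "?e ` {1..m} \<subseteq> V"
    using assms(2,5) by (auto simp: subset_iff)
  moreover have "?s i \<in> {1, -1}" for i
  proof (cases "i \<in> {1..m}")
    case True
    then have "ss ! (i - 1) \<in> set ss" using assms(3) by (intro nth_mem) auto
    with True show ?thesis using assms(6) by auto
  qed auto
  ultimately show ?thesis
    unfolding contains_L_def by (intro exI[of _ ?e] exI[of _ ?s] conjI allI ballI)
qed

lemma contains_L_sign_change:
  assumes "contains_L m V (\<lambda>x y. d x * d y * f x y)" "\<And>x. x \<in> V \<Longrightarrow> d x \<in> {1, -1}"
  shows "contains_L m V f"
proof -
  obtain e s where es: "inj_on e {1..m}" "e ` {1..m} \<subseteq> V" "\<And>i. s i \<in> {1, -1 :: int}"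
    and eq: "\<And>i j. i \<in> {1..m} \<Longrightarrow> j \<in> {1..m} \<Longrightarrow>
      d (e i) * d (e j) * f (e i) (e j) = s i * s j * sg (Ltour m) i j"
    using assms(1) unfolding contains_L_def by blast
  let ?s = "\<lambda>i. if i \<in> {1..m} then d (e i) * s i else 1"
  have dV: "d (e i) \<in> {1, -1}" if "i \<in> {1..m}" for i
    using that es(2) assms(2) by blast
  have "f (e i) (e j) = ?s i * ?s j * sg (Ltour m) i j" if "i \<in> {1..m}" "j \<in> {1..m}" for i j
  proof -
    have "f (e i) (e j) = d (e i) * d (e j) * (d (e i) * d (e j) * f (e i) (e j))"
      using dV[OF that(1)] dV[OF that(2)] by auto
    then show ?thesis
      using that by (simp add: eq[OF that])
  qed
  moreover have "?s i \<in> {1, -1}" for i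
    using dV[of i] es(3)[of i] by auto
  ultimately show ?thesis
    unfolding contains_L_def using es(1,2)
    by (intro exI[of _ e] exI[of _ ?s] conjI allI ballI)
qed

section \<open>Sign matrices with principal minors at most 25, and conflicting vertices\<close>

locale sign_system =
  fixes V :: "'a set" and f :: "'a \<Rightarrow> 'a \<Rightarrow> int"
  assumes skew: "skew f"
    and unit: "x \<in> V \<Longrightarrow> y \<in> V \<Longrightarrow> x \<noteq> y \<Longrightarrow> f x y \<in> {1, -1}"
    and bounded: "distinct vs \<Longrightarrow> set vs \<subseteq> V \<Longrightarrow> sdet f vs \<le> 25"

text \<open>Stability under switching is the reason to work with sign matrices: configurations can
  be normalised without leaving the locale.\<close>

lemma (in sign_system) sign_change:
  assumes "\<And>x. x \<in> V \<Longrightarrow> d x \<in> {1, -1}"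
  shows "sign_system V (\<lambda>x y. d x * d y * f x y)"
proof
  show "skew (\<lambda>x y. d x * d y * f x y)" by (rule skew_scale[OF skew])
  show "d x * d y * f x y \<in> {1, -1}" if "x \<in> V" "y \<in> V" "x \<noteq> y" for x y
    using assms[OF that(1)] assms[OF that(2)] unit[OF that] by auto
  show "sdet (\<lambda>x y. d x * d y * f x y) vs \<le> 25" if "distinct vs" "set vs \<subseteq> V" for vs
    using bounded[OF that] assms that(2) by (subst sdet_sign_change) auto
qed

text \<open>Here \<open>u\<close> dominates the 3-cycle \<open>v\<close>, \<open>p\<close>,
  \<open>q\<close>, which is \<open>L\<^sub>4\<close> up to switching; \<open>x\<close> sees the
  others like \<open>u\<close> and \<open>y\<close> like \<open>v\<close>, except for the reversed
  arc between \<open>x\<close> and \<open>y\<close>. Only the signs \<open>f u x\<close> and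
  \<open>f v y\<close> are free.\<close>

lemma (in sign_system) conflict_normal:
  assumes "distinct [u, x, v, y, p, q]" "{u, x, v, y, p, q} \<subseteq> V"
    and "f u v = 1" "f u p = 1" "f u q = 1" "f v p = 1" "f p q = 1" "f v q = -1"
    and "f x v = 1" "f x p = 1" "f x q = 1" "f u y = 1" "f y p = 1" "f y q = -1" "f x y = -1"
  shows "contains_L 6 V f"
proof -
  have ux: "f u x \<in> {1, -1}" and vy: "f v y \<in> {1, -1}"
    by (rule unit; use assms(1,2) in simp)+
  have "sdet f [u, x, v, y, p, q] \<le> 25"
    by (rule bounded) (use assms(1,2) in auto)
  \<comment> \<open>This Pfaffian equals \<open>f u x * f v y + 6\<close>. Equal signs give 7 and
    violate the bound. Opposite signs give 5; for each such case an order of the six vertices and a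
    switching exhibit \<open>L\<^sub>6\<close>.\<close>
  then have bd: "(pf6 f u x v y p q)\<^sup>2 \<le> 25"
    by (simp only: sdet_6[OF skew ux])
  have rev: "f v x = -1" "f y x = 1" "f y v = - f v y" "f x u = - f u x" "f q v = 1" "f q x = -1"
    "f q y = 1" "f q p = -1"
    using skewD[OF skew, of v x] skewD[OF skew, of y x] skewD[OF skew, of y v] skewD[OF skew, of x u]
      skewD[OF skew, of q v] skewD[OF skew, of q x] skewD[OF skew, of q y] skewD[OF skew, of q p] assms
    by simp_all
  have cases: "i = 0 \<and> j \<in> {1, 2, 3, 4, 5} \<or> i = 1 \<and> j \<in> {2, 3, 4, 5} \<or> i = 2 \<and> j \<in> {3, 4, 5} \<or>
      i = 3 \<and> j \<in> {4, 5} \<or> i = 4 \<and> j = 5" if "i < j" "j < 6" for i j :: nat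
    using that by (auto simp: numeral_eq_Suc less_Suc_eq)
  from ux vy consider "f u x = 1" "f v y = 1" | "f u x = 1" "f v y = -1"
    | "f u x = -1" "f v y = 1" | "f u x = -1" "f v y = -1"
    by blast
  then show ?thesis
  proof cases
    case 2
    show ?thesis
    proof (rule contains_L_listI[OF skew, of "[u, y, x, v, p, q]" _ "[1, 1, 1, 1, 1, -1]"])
      fix i j :: nat assume "i < j" "j < 6"
      from cases[OF this] show "f ([u, y, x, v, p, q] ! i) ([u, y, x, v, p, q] ! j) =
          [1, 1, 1, 1, 1, -1] ! i * [1, 1, 1, 1, 1, -1] ! j * sg (Ltour 6) (Suc i) (Suc j)"
        by (elim disjE conjE insertE emptyE; simp add: sg_Ltour assms(3-) rev 2)
    qed (use assms(1,2) in auto)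
  next
    case 3
    show ?thesis
    proof (rule contains_L_listI[OF skew, of "[u, q, v, x, y, p]" _ "[1, 1, 1, -1, 1, -1]"])
      fix i j :: nat assume "i < j" "j < 6"
      from cases[OF this] show "f ([u, q, v, x, y, p] ! i) ([u, q, v, x, y, p] ! j) =
          [1, 1, 1, -1, 1, -1] ! i * [1, 1, 1, -1, 1, -1] ! j * sg (Ltour 6) (Suc i) (Suc j)"
        by (elim disjE conjE insertE emptyE; simp add: sg_Ltour assms(3-) rev 3)
    qed (use assms(1,2) in auto)
  qed (use bd assms(3-) rev in \<open>simp_all add: pf6_def pf4_def\<close>)
qed

lemma (in sign_system) diamond_conflict:
  assumes V: "distinct [u, x, v, y, p, q]" "{u, x, v, y, p, q} \<subseteq> V"
    and pf: "(pf4 f u v p q)\<^sup>2 = 9"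
    and x: "f x v = f u v" "f x p = f u p" "f x q = f u q"
    and y: "f u y = f u v" "f y p = f v p" "f y q = f v q"
    and xy: "f x y \<noteq> f u v"
  shows "contains_L 6 V f"
proof -
  \<comment> \<open>\<open>u\<close> and \<open>x\<close> stay as they are; the others are switched
    so that \<open>u\<close> dominates \<open>v\<close>, \<open>p\<close>, \<open>q\<close>, and
    \<open>y\<close> takes the sign of its model \<open>v\<close>.\<close>
  define d where "d z = (if z = v \<or> z = y then f u v else if z = p then f u p
    else if z = q then f u q else 1)" for z
  define g where "g = (\<lambda>x y. d x * d y * f x y)"
  have units: "f u v \<in> {1, -1}" "f u p \<in> {1, -1}" "f u q \<in> {1, -1}" "f v p \<in> {1, -1}"
    "f v q \<in> {1, -1}" "f p q \<in> {1, -1}" "f x y \<in> {1, -1}"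
    by (rule unit; use V in simp)+
  have d: "d z \<in> {1, -1}" for z
    using units(1-3) by (simp add: d_def)
  interpret g: sign_system V g
    unfolding g_def by (rule sign_change) (rule d)
  have dv: "d u = 1" "d x = 1" "d v = f u v" "d y = f u v" "d p = f u p" "d q = f u q"
    using V(1) by (auto simp: d_def)
  have sq: "f u v * f u v = 1" "f u p * f u p = 1" "f u q * f u q = 1"
    using units(1-3) by auto
  have g1: "g u v = 1" "g u p = 1" "g u q = 1" "g x v = 1" "g x p = 1" "g x q = 1" "g u y = 1"
    by (simp_all add: g_def dv sq x y)
  have g2: "g y p = g v p" "g y q = g v q" by (simp_all add: g_def dv y)
  have gxy: "g x y = -1"
    using xy units(1,7) by (auto simp: g_def dv)
  have "pf4 g u v p q = f u v * f u p * f u q * pf4 f u v p q"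
    using units(1-3) by (auto simp: pf4_def g_def dv)
  then have "(pf4 g u v p q)\<^sup>2 = 9"
    using units(1-3) pf by (auto simp: power_mult_distrib)
  then have pfg: "(g p q - g v q + g v p)\<^sup>2 = 9"
    by (simp add: pf4_def g1)
  have gu: "g p q \<in> {1, -1}" "g v q \<in> {1, -1}" "g v p \<in> {1, -1}"
    by (rule g.unit; use V in simp)+
  \<comment> \<open>A sum of three signs with square 9 has equal terms, so \<open>v\<close>,
    \<open>p\<close>, \<open>q\<close> form a 3-cycle in one of two directions; swapping
    \<open>p\<close> and \<open>q\<close> exchanges them.\<close>
  from pfg gu consider "g p q = 1" "g v q = -1" "g v p = 1" | "g p q = -1" "g v q = 1" "g v p = -1"
    by auto
  then have "contains_L 6 V g"
  proof cases
    case 1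
    show ?thesis
      by (rule g.conflict_normal[of u x v y p q]) (use V g1 g2 gxy 1 in auto)
  next
    case 2
    then have "g q p = 1" using skewD[OF g.skew, of q p] by simp
    show ?thesis
      by (rule g.conflict_normal[of u x v y q p]) (use V g1 g2 gxy 2 \<open>g q p = 1\<close> in auto)
  qed
  then show ?thesis
    unfolding g_def by (rule contains_L_sign_change) (rule d)
qed

lemma list_length_4E:
  assumes "length xs = 4"
  obtains p q r s where "xs = [p, q, r, s]"
  using assms by (auto simp: numeral_eq_Suc length_Suc_conv)

text \<open>Eliminating \<open>u\<close>, \<open>x\<close> shows that a wrong arc makes the Pfaffian
  on all eight vertices at least \<open>2 * 5 - 3 = 7\<close> in modulus.\<close>

lemma (in sign_system) six_conflict:
  assumes V: "distinct [u, x, v, y, p, q, r, s]" "{u, x, v, y, p, q, r, s} \<subseteq> V"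
    and pf: "sdet f [p, q, u, v, r, s] = 25"
    and x: "\<And>z. z \<in> {v, p, q, r, s} \<Longrightarrow> f x z = f u z"
    and y: "\<And>z. z \<in> {u, p, q, r, s} \<Longrightarrow> f y z = f v z"
  shows "f x y = f u v"
proof (rule ccontr)
  assume neq: "f x y \<noteq> f u v"
  have ux: "f u x \<in> {1, -1}" and uv: "f u v \<in> {1, -1}" and xy: "f x y \<in> {1, -1}"
    and pq: "f p q \<in> {1, -1}" and yv: "f y v \<in> {1, -1}"
    and pq': "f p r \<in> {1, -1}" "f p s \<in> {1, -1}" "f q r \<in> {1, -1}" "f q s \<in> {1, -1}"
      "f r s \<in> {1, -1}"
    by (rule unit; use V in force)+
  define g where "g = pivot f u x"
  define k where "k = 2 * f u x * f u v"
  have yu: "f y u = - f u v"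
    using y[of u] skewD[OF skew, of v u] by simp
  have yx: "f y x = f u v"
    using skewD[OF skew, of y x] neq uv xy by auto
  have x': "f z x = f z u" if "z \<in> {v, p, q, r, s}" for z
    using x[OF that] skewD[OF skew, of z x] skewD[OF skew, of z u] by simp
  \<comment> \<open>Since \<open>u\<close> and \<open>x\<close> differ only at \<open>y\<close>,
    eliminating them changes only the row and column of \<open>y\<close>, by the multiple
    \<open>k\<close> of those of \<open>u\<close>.\<close>
  have g_other: "g a b = f a b" if "a \<in> {v, p, q, r, s}" "b \<in> {v, p, q, r, s}" for a b
    by (simp add: g_def pivot_def x[OF that(2)] x'[OF that(1)])
  have g_y: "g y b = f y b - k * f u b" if "b \<in> {v, p, q, r, s}" for b
    by (simp add: g_def pivot_def x[OF that] yu yx k_def algebra_simps)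
  have g_y': "g b y = f b y - k * f b u" if "b \<in> {v, p, q, r, s}" for b
    using g_y[OF that] skewD[OF skew_pivot[OF skew], of u x b y] skewD[OF skew, of b y]
      skewD[OF skew, of b u]
    by (simp add: g_def)
  \<comment> \<open>The Pfaffian is linear in the row of \<open>y\<close>. Putting \<open>p\<close>,
    \<open>q\<close> first gives \<open>sdet_6\<close> a unit entry that the elimination leaves
    unchanged.\<close>
  have "pf6 g p q y v r s = pf6 f p q y v r s - k * pf6 f p q u v r s"
    by (simp add: pf6_def pf4_def g_other g_y g_y' algebra_simps)
  moreover have "(pf6 f p q u v r s)\<^sup>2 = 25"
    using pf by (simp add: sdet_6[OF skew pq])
  then have "\<bar>pf6 f p q u v r s\<bar> = 5"
    using power2_eq_iff[of "pf6 f p q u v r s" 5] by auto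
  moreover have "\<bar>k\<bar> = 2"
    using ux uv by (auto simp: k_def)
  \<comment> \<open>\<open>y\<close> and \<open>v\<close> are twins with respect to
    \<open>p\<close>, \<open>q\<close>, \<open>r\<close>, \<open>s\<close>, so this Pfaffian is
    \<open>pf4 f p q r s\<close> up to sign, a sum of three signs.\<close>
  moreover have "\<bar>pf6 f p q y v r s\<bar> \<le> 3"
  proof -
    have abs1: "\<bar>t\<bar> = 1" if "t \<in> {1, -1}" for t :: int
      using that by auto
    have "(pf6 f p q y v r s)\<^sup>2 = sdet f [p, q, y, v, r, s]"
      by (simp only: sdet_6[OF skew pq])
    also have "\<dots> = sdet f (y # v # [p, q, r, s])"
      by (rule sdet_perm) simp
    also have "\<dots> = sdet f [p, q, r, s]"
      by (rule sdet_twins[OF skew yv]) (use y in auto)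
    also have "\<dots> = (pf4 f p q r s)\<^sup>2"
      by (rule sdet_4[OF skew])
    finally have "\<bar>pf6 f p q y v r s\<bar> = \<bar>pf4 f p q r s\<bar>"
      by (simp add: power2_eq_iff abs_eq_iff)
    also have "\<dots> \<le> \<bar>f p q * f r s\<bar> + \<bar>f p r * f q s\<bar> + \<bar>f p s * f q r\<bar>"
      unfolding pf4_def by linarith
    also have "\<dots> = 3"
      by (simp add: abs_mult abs1[OF pq] pq'[THEN abs1])
    finally show ?thesis .
  qed
  ultimately have "pf6 g p q y v r s = pf6 f p q y v r s - k * pf6 f p q u v r s"
      "\<bar>k * pf6 f p q u v r s\<bar> = 10" "\<bar>pf6 f p q y v r s\<bar> \<le> 3"
    by (simp_all add: abs_mult)
  then have "7 \<le> \<bar>pf6 g p q y v r s\<bar>"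
    by linarith
  then have "7\<^sup>2 \<le> (pf6 g p q y v r s)\<^sup>2"
    using power_mono[of 7 "\<bar>pf6 g p q y v r s\<bar>" 2] by simp
  moreover have "sdet f (u # x # [p, q, y, v, r, s]) = (pf6 g p q y v r s)\<^sup>2"
    unfolding sdet_pivot[OF skew ux]
    by (simp only: g_def[symmetric]) (rule sdet_6, simp add: g_def skew_pivot[OF skew], simp add: g_other pq[simplified])
  moreover have "sdet f (u # x # [p, q, y, v, r, s]) \<le> 25"
    by (rule bounded) (use V in auto)
  ultimately show False by simp
qed

text \<open>The copy \<open>l\<close> of \<open>L\<^sub>m\<close>, where each vertex \<open>x\<close> has already been switched so that it sees the copy
  exactly like \<open>l (\<tau> x)\<close>, except possibly at \<open>l (\<tau> x)\<close> itself.\<close>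

locale typed_copy = sign_system V f for V :: "'a set" and f +
  fixes m :: nat and l :: "nat \<Rightarrow> 'a" and \<tau> :: "'a \<Rightarrow> nat"
  assumes m: "m \<in> {4, 6}"
    and l: "i \<in> {1..m} \<Longrightarrow> l i \<in> V" "i \<in> {1..m} \<Longrightarrow> \<tau> (l i) = i"
    and \<tau>: "x \<in> V \<Longrightarrow> \<tau> x \<in> {1..m}"
    and sees: "x \<in> V \<Longrightarrow> j \<in> {1..m} \<Longrightarrow> j \<noteq> \<tau> x \<Longrightarrow> f x (l j) = sg (Ltour m) (\<tau> x) j"
begin

lemma arcs_l:
  assumes "i \<in> {1..m}" "j \<in> {1..m}"
  shows "f (l i) (l j) = sg (Ltour m) i j"
  using sees[of "l i" j] l[OF assms(1)] assms skew_self[OF skew, of "l i"] skew_self[OF skew_Ltour, of m i]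
  by (cases "i = j") auto

text \<open>Replacing \<open>l (\<tau> x)\<close> by \<open>x\<close> gives another exact copy of
  \<open>L\<^sub>m\<close>.\<close>

lemma sdet_transversal:
  assumes "x \<in> V" "distinct js" "set js = {1..m} - {\<tau> x}"
  shows "sdet f (x # map l js) = (int m - 1)\<^sup>2"
proof -
  let ?l = "l(\<tau> x := x)"
  have "f (?l i) (?l j) = sg (Ltour m) i j" if "i \<in> {1..m}" "j \<in> {1..m}" for i j
  proof -
    have rev: "f (l i) x = - f x (l i)" "sg (Ltour m) i (\<tau> x) = - sg (Ltour m) (\<tau> x) i"
      by (rule skewD[OF skew], rule skewD[OF skew_Ltour])
    consider "i = \<tau> x" "j = \<tau> x" | "i = \<tau> x" "j \<noteq> \<tau> x" | "i \<noteq> \<tau> x" "j = \<tau> x"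
      | "i \<noteq> \<tau> x" "j \<noteq> \<tau> x" by blast
    then show ?thesis
    proof cases
      case 1
      then show ?thesis by (simp add: skew_self[OF skew] skew_self[OF skew_Ltour])
    next
      case 2
      then show ?thesis by (simp add: sees[OF assms(1) that(2)])
    next
      case 3
      then show ?thesis by (simp add: rev sees[OF assms(1) that(1)])
    next
      case 4
      then show ?thesis by (simp add: arcs_l[OF that])
    qed
  qed
  moreover have set: "set (\<tau> x # js) = {1..m}"
    using \<tau>[OF assms(1)] unfolding list.set(2) assms(3) by blast
  ultimately have "sdet f (map ?l (\<tau> x # js)) = sdet (sg (Ltour m)) (\<tau> x # js)"
    unfolding sdet_map by (intro sdet_cong) blast
  also have "map ?l (\<tau> x # js) = x # map l js"
    using assms(3) by auto
  also have "sdet (sg (Ltour m)) (\<tau> x # js) = (int m - 1)\<^sup>2"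
    by (rule sdet_Ltour[OF _ set m]) (use assms in auto)
  finally show ?thesis .
qed

text \<open>The three vertices see the rest of the copy alike, so \<open>sdet_cyclic_triple\<close>
  yields a minor \<open>9 * (m - 1)^2\<close>, which is at least 81.\<close>

lemma block_acyclic:
  assumes V: "x \<in> V" "y \<in> V" "z \<in> V" and \<tau>_eq: "\<tau> x = \<tau> z" "\<tau> y = \<tau> z"
    and cyc: "f x y = 1" "f y z = 1" "f z x = 1"
  shows False
proof -
  obtain js where js: "distinct js" "set js = {1..m} - {\<tau> z}"
    using finite_distinct_list[of "{1..m} - {\<tau> z}"] by auto
  have neq: "x \<noteq> y" "y \<noteq> z" "z \<noteq> x"
    using cyc skew_self[OF skew] by auto
  have out: "w \<notin> set (map l js)" if "\<tau> w = \<tau> z" for w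
    using that js(2) l(2) by auto
  have "inj_on l (set js)"
    by (rule inj_on_inverseI[of _ \<tau>]) (use js(2) l(2) in auto)
  then have dist: "distinct (x # y # z # map l js)"
    using js(1) neq out[of x] out[of y] out[of z] \<tau>_eq by (simp add: distinct_map del: set_map)
  have "sdet f (x # y # z # map l js) = 9 * sdet f (z # map l js)"
  proof (rule sdet_cyclic_triple[OF skew cyc])
    show "distinct (z # map l js)" using dist by simp
    fix w assume "w \<in> set (map l js)"
    then obtain j where "w = l j" "j \<in> set js" by auto
    then show "f x w = f z w" "f y w = f z w"
      using sees[of _ j] V \<tau>_eq js(2) by simp_all
  qed
  also have "sdet f (z # map l js) = (int m - 1)\<^sup>2"
    by (rule sdet_transversal[OF V(3) js])
  finally have "sdet f (x # y # z # map l js) > 25"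
    using m by auto
  moreover have "sdet f (x # y # z # map l js) \<le> 25"
    by (rule bounded[OF dist]) (use V js(2) l(1) in auto)
  ultimately show False by simp
qed

text \<open>\<open>x\<close> and its model \<open>u = l (\<tau> x)\<close> agree on the rest of the
  copy, and so do \<open>y\<close> and its model \<open>v = l (\<tau> y)\<close>. A wrong arc
  between \<open>x\<close> and \<open>y\<close> is then a conflict, impossible for
  \<open>L\<^sub>6\<close> and producing a copy of \<open>L\<^sub>6\<close> for
  \<open>L\<^sub>4\<close>; hence \<open>no6\<close>.\<close>

lemma cross_consistent:
  assumes V: "x \<in> V" "y \<in> V" and neq: "\<tau> x \<noteq> \<tau> y"
    and no6: "m = 4 \<Longrightarrow> \<not> contains_L 6 V f"
  shows "f x y = sg (Ltour m) (\<tau> x) (\<tau> y)"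
proof (rule ccontr)
  assume wrong: "f x y \<noteq> sg (Ltour m) (\<tau> x) (\<tau> y)"
  define i j u v where "i = \<tau> x" and "j = \<tau> y" and "u = l i" and "v = l j"
  have ij: "i \<in> {1..m}" "j \<in> {1..m}" "i \<noteq> j"
    using \<tau> V neq by (auto simp: i_def j_def)
  have uv: "f u v = sg (Ltour m) i j"
    using arcs_l ij by (simp add: u_def v_def)
  \<comment> \<open>A wrong arc rules out \<open>y = v\<close>, since \<open>x\<close> sees the copy
    correctly; \<open>x = u\<close> is then ruled out in the same way.\<close>
  have "f x (l j) = sg (Ltour m) i j"
    using sees[OF V(1) ij(2)] ij by (simp add: i_def)
  then have yv: "y \<noteq> v" using wrong by (auto simp: v_def i_def j_def)
  have "f y (l i) = sg (Ltour m) j i"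
    using sees[OF V(2) ij(1)] ij by (simp add: j_def)
  moreover have "f (l i) y = - f y (l i)" "sg (Ltour m) i j = - sg (Ltour m) j i"
    by (rule skewD[OF skew], rule skewD[OF skew_Ltour])
  ultimately have "f (l i) y = sg (Ltour m) i j" by simp
  then have xu: "x \<noteq> u" using wrong by (auto simp: u_def i_def j_def)
  obtain ks where ks: "distinct ks" "set ks = {1..m} - {i, j}"
    using finite_distinct_list[of "{1..m} - {i, j}"] by auto
  have len: "length ks = m - 2"
    using distinct_card[OF ks(1)] ij by (simp add: ks(2) card_Diff_subset)
  have lV: "u \<in> V" "v \<in> V" "set (map l ks) \<subseteq> V"
    using l(1) ij ks(2) by (auto simp: u_def v_def)
  have inj: "inj_on l {1..m}"
    by (rule inj_on_inverseI[of _ \<tau>]) (use l(2) in auto)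
  have \<tau>_ks: "\<tau> z \<noteq> i" "\<tau> z \<noteq> j" if "z \<in> set (map l ks)" for z
    using that ks(2) l(2) by auto
  have \<tau>_uv: "\<tau> u = i" "\<tau> v = j" using l(2) ij by (simp_all add: u_def v_def)
  have "distinct (map l ks)"
    using ks inj_on_subset[OF inj, of "set ks"] by (auto simp: distinct_map)
  moreover have "{u, x, v, y} \<inter> set (map l ks) = {}"
    using \<tau>_ks[of u] \<tau>_ks[of x] \<tau>_ks[of v] \<tau>_ks[of y] \<tau>_uv i_def j_def
    by (auto simp del: set_map)
  moreover have "distinct [u, x, v, y]"
    using \<tau>_uv xu yv ij(3) i_def j_def by auto
  ultimately have dist: "distinct ([u, x, v, y] @ map l ks)"
    by (simp only: distinct_append set_simps)
  have jks: "distinct (j # ks)" "set (j # ks) = {1..m} - {\<tau> u}"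
    unfolding \<tau>_uv list.set(2) distinct.simps(2) ks(2) using ks(1) ij by blast+
  have iks: "set (i # ks) = {1..m} - {j}"
    unfolding list.set(2) ks(2) using ij by blast
  have det_uv: "sdet f (u # v # map l ks) = (int m - 1)\<^sup>2"
    using sdet_transversal[OF lV(1) jks] by (simp add: v_def)
  have x: "f x z = f u z" if "z \<in> insert v (set (map l ks))" for z
  proof -
    have "z \<in> l ` set (j # ks)"
      using that by (simp add: v_def)
    then obtain k where "z = l k" "k \<in> {1..m}" "k \<noteq> i"
      unfolding jks(2) \<tau>_uv by blast
    then show ?thesis
      using sees[OF V(1), of k] arcs_l[OF ij(1), of k] by (simp add: i_def u_def)
  qed
  have y: "f y z = f v z" if "z \<in> insert u (set (map l ks))" for z
  proof -
    have "z \<in> l ` set (i # ks)"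
      using that by (simp add: u_def)
    then obtain k where "z = l k" "k \<in> {1..m}" "k \<noteq> j"
      unfolding iks by blast
    then show ?thesis
      using sees[OF V(2), of k] arcs_l[OF ij(2), of k] by (simp add: j_def v_def)
  qed
  have neq_uv: "f x y \<noteq> f u v" using wrong uv by (simp add: i_def j_def)
  consider "m = 4" | "m = 6" using m by blast
  then show False
  proof cases
    case 1
    then obtain p q where pq: "map l ks = [p, q]"
      using len by (auto simp: length_Suc_conv numeral_2_eq_2)
    have "(pf4 f u v p q)\<^sup>2 = 9"
      using det_uv 1 by (simp add: pq sdet_4[OF skew])
    moreover have "f u y = f u v"
      using y[of u] skewD[OF skew, of u y] skewD[OF skew, of u v] by simp
    ultimately have "contains_L 6 V f"
    proof (intro diamond_conflict[of u x v y p q])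
      show "distinct [u, x, v, y, p, q]" using dist unfolding pq by simp
      show "{u, x, v, y, p, q} \<subseteq> V" using lV V unfolding pq by simp
    qed (use x y neq_uv in \<open>simp_all add: pq\<close>)
    then show False using no6 1 by blast
  next
    case 2
    then have "length (map l ks) = 4" using len by simp
    then obtain p q r s where pq: "map l ks = [p, q, r, s]"
      using list_length_4E by blast
    have "sdet f [p, q, u, v, r, s] = sdet f (u # v # map l ks)"
      unfolding pq by (rule sdet_perm) simp
    then have "sdet f [p, q, u, v, r, s] = 25" using det_uv 2 by simp
    then have "f x y = f u v"
    proof (intro six_conflict[of u x v y p q r s])
      show "distinct [u, x, v, y, p, q, r, s]" using dist unfolding pq by simp
      show "{u, x, v, y, p, q, r, s} \<subseteq> V" using lV V unfolding pq by simp
    qed (use x y in \<open>simp_all only: pq list.set\<close>)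
    then show False using neq_uv by blast
  qed
qed

end

section \<open>Vertex types: the ways to see a copy of \<open>L\<^sub>4\<close> or
  \<open>L\<^sub>6\<close>\<close>

lemma sg_Ltour_rev:
  assumes "1 \<le> j" "j < i" "i \<le> m"
  shows "sg (Ltour m) i j = (if i < m \<or> even j then -1 else 1)"
  using sg_Ltour[OF assms] skewD[OF skew_Ltour, of m i j] by simp

text \<open>Four rows, two signs and a free entry at \<open>i\<close> produce sixteen vectors, and
  these are all sign vectors of length four.\<close>

lemma sign_vector_type_4:
  assumes "\<And>j. j \<in> {1..4} \<Longrightarrow> X j \<in> {1, -1 :: int}"
  shows "\<exists>i\<in>{1..4}. \<exists>\<sigma>\<in>{1, -1}. \<forall>j\<in>{1..4}. j \<noteq> i \<longrightarrow> X j = \<sigma> * sg (Ltour 4) i j"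
proof -
  have "X 1 \<in> {1, -1}" "X 2 \<in> {1, -1}" "X 3 \<in> {1, -1}" "X 4 \<in> {1, -1}"
    by (rule assms; simp)+
  then show ?thesis
    unfolding interval_1_4
    by (simp add: sg_Ltour sg_Ltour_rev) (elim disjE; simp)
qed

text \<open>The linear forms are the Pfaffians of a new vertex together with five vertices of \<open>L\<^sub>6\<close>; the
  disjuncts are the rows of the sign matrix of \<open>L\<^sub>6\<close>.\<close>

lemma six_signs:
  fixes a b c d e g :: int
  assumes "a \<in> {1, -1}" "b \<in> {1, -1}" "c \<in> {1, -1}" "d \<in> {1, -1}" "e \<in> {1, -1}" "g \<in> {1, -1}"
    and "\<bar>- 3 * b + c + d - 3 * e + g\<bar> \<le> 5" "\<bar>- 3 * a + 3 * c - d - e + g\<bar> \<le> 5"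
      "\<bar>- a + 3 * b - 3 * d + e + g\<bar> \<le> 5" "\<bar>a + b - 3 * c + 3 * e + g\<bar> \<le> 5"
      "\<bar>3 * a - b - c + 3 * d + g\<bar> \<le> 5"
  shows "\<exists>\<sigma>\<in>{1, -1}.
    b = \<sigma> \<and> c = \<sigma> \<and> d = \<sigma> \<and> e = \<sigma> \<and> g = - \<sigma> \<or>
    a = - \<sigma> \<and> c = \<sigma> \<and> d = \<sigma> \<and> e = \<sigma> \<and> g = \<sigma> \<or>
    a = - \<sigma> \<and> b = - \<sigma> \<and> d = \<sigma> \<and> e = \<sigma> \<and> g = - \<sigma> \<or>
    a = - \<sigma> \<and> b = - \<sigma> \<and> c = - \<sigma> \<and> e = \<sigma> \<and> g = \<sigma> \<or>
    a = - \<sigma> \<and> b = - \<sigma> \<and> c = - \<sigma> \<and> d = - \<sigma> \<and> g = - \<sigma> \<or>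
    a = \<sigma> \<and> b = - \<sigma> \<and> c = \<sigma> \<and> d = - \<sigma> \<and> e = \<sigma>"
proof -
  have u: "x = 1 \<or> x = -1" if "x \<in> {1, -1}" for x :: int
    using that by simp
  show ?thesis
    using assms(7-) assms(1-6)[THEN u] by (elim disjE) (simp_all only:, simp_all)
qed

text \<open>The Pfaffian on \<open>x\<close> and five vertices of the copy is a linear form in the
  signs of \<open>x\<close>, with square at most 25. The five forms that omit one of
  \<open>l 1\<close> to \<open>l 5\<close> feed \<open>six_signs\<close>, which leaves only the rows
  of \<open>L\<^sub>6\<close> up to sign.\<close>

lemma (in sign_system) sign_vector_type_6:
  assumes l: "\<And>i. i \<in> {1..6} \<Longrightarrow> l i \<in> V" "inj_on l {1..6}"
    and exact: "\<And>i j. i \<in> {1..6} \<Longrightarrow> j \<in> {1..6} \<Longrightarrow> f (l i) (l j) = sg (Ltour 6) i j"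
    and x: "x \<in> V" "x \<notin> l ` {1..6}"
  shows "\<exists>i\<in>{1..6}. \<exists>\<sigma>\<in>{1, -1}. \<forall>j\<in>{1..6}. j \<noteq> i \<longrightarrow> f x (l j) = \<sigma> * sg (Ltour 6) i j"
proof -
  have unit_x: "f x (l j) \<in> {1, -1}" if "j \<in> {1..6}" for j
    using that x l(1) by (intro unit) auto
  have pf: "\<bar>pf6 f x (l i1) (l i2) (l i3) (l i4) (l i5)\<bar> \<le> 5"
    if "distinct [i1, i2, i3, i4, i5]" "{i1, i2, i3, i4, i5} \<subseteq> {1..6}" for i1 i2 i3 i4 i5
  proof -
    have "distinct (map l [i1, i2, i3, i4, i5])"
      using that inj_on_subset[OF l(2)] by (simp only: distinct_map list.set)
    moreover have "x \<notin> set (map l [i1, i2, i3, i4, i5])"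
      using x(2) that(2) by auto
    ultimately have "sdet f (x # map l [i1, i2, i3, i4, i5]) \<le> 25"
      using x(1) l(1) that(2) by (intro bounded) auto
    then have "(pf6 f x (l i1) (l i2) (l i3) (l i4) (l i5))\<^sup>2 \<le> 5\<^sup>2"
      using unit_x[of i1] that(2) by (simp add: sdet_6[OF skew])
    then show ?thesis
      using abs_le_square_iff[of _ "5::int"] by simp
  qed
  have units: "f x (l 1) \<in> {1, -1}" "f x (l 2) \<in> {1, -1}" "f x (l 3) \<in> {1, -1}"
    "f x (l 4) \<in> {1, -1}" "f x (l 5) \<in> {1, -1}" "f x (l 6) \<in> {1, -1}"
    by (rule unit_x; simp)+
  have pf_eqs: "pf6 f x (l 2) (l 3) (l 4) (l 5) (l 6) =
      - 3 * f x (l 2) + f x (l 3) + f x (l 4) - 3 * f x (l 5) + f x (l 6)"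
    "pf6 f x (l 1) (l 3) (l 4) (l 5) (l 6) =
      - 3 * f x (l 1) + 3 * f x (l 3) - f x (l 4) - f x (l 5) + f x (l 6)"
    "pf6 f x (l 1) (l 2) (l 4) (l 5) (l 6) =
      - f x (l 1) + 3 * f x (l 2) - 3 * f x (l 4) + f x (l 5) + f x (l 6)"
    "pf6 f x (l 1) (l 2) (l 3) (l 5) (l 6) =
      f x (l 1) + f x (l 2) - 3 * f x (l 3) + 3 * f x (l 5) + f x (l 6)"
    "pf6 f x (l 1) (l 2) (l 3) (l 4) (l 6) =
      3 * f x (l 1) - f x (l 2) - f x (l 3) + 3 * f x (l 4) + f x (l 6)"
    by (simp_all add: pf6_def pf4_def exact sg_Ltour)
  have ineqs: "\<bar>- 3 * f x (l 2) + f x (l 3) + f x (l 4) - 3 * f x (l 5) + f x (l 6)\<bar> \<le> 5"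
    "\<bar>- 3 * f x (l 1) + 3 * f x (l 3) - f x (l 4) - f x (l 5) + f x (l 6)\<bar> \<le> 5"
    "\<bar>- f x (l 1) + 3 * f x (l 2) - 3 * f x (l 4) + f x (l 5) + f x (l 6)\<bar> \<le> 5"
    "\<bar>f x (l 1) + f x (l 2) - 3 * f x (l 3) + 3 * f x (l 5) + f x (l 6)\<bar> \<le> 5"
    "\<bar>3 * f x (l 1) - f x (l 2) - f x (l 3) + 3 * f x (l 4) + f x (l 6)\<bar> \<le> 5"
    unfolding pf_eqs[symmetric] by (rule pf; simp)+
  obtain \<sigma> where \<sigma>: "\<sigma> \<in> {1, -1}"
    "f x (l 2) = \<sigma> \<and> f x (l 3) = \<sigma> \<and> f x (l 4) = \<sigma> \<and> f x (l 5) = \<sigma> \<and> f x (l 6) = - \<sigma> \<or>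
    f x (l 1) = - \<sigma> \<and> f x (l 3) = \<sigma> \<and> f x (l 4) = \<sigma> \<and> f x (l 5) = \<sigma> \<and> f x (l 6) = \<sigma> \<or>
    f x (l 1) = - \<sigma> \<and> f x (l 2) = - \<sigma> \<and> f x (l 4) = \<sigma> \<and> f x (l 5) = \<sigma> \<and> f x (l 6) = - \<sigma> \<or>
    f x (l 1) = - \<sigma> \<and> f x (l 2) = - \<sigma> \<and> f x (l 3) = - \<sigma> \<and> f x (l 5) = \<sigma> \<and> f x (l 6) = \<sigma> \<or>
    f x (l 1) = - \<sigma> \<and> f x (l 2) = - \<sigma> \<and> f x (l 3) = - \<sigma> \<and> f x (l 4) = - \<sigma> \<and> f x (l 6) = - \<sigma> \<or>
    f x (l 1) = \<sigma> \<and> f x (l 2) = - \<sigma> \<and> f x (l 3) = \<sigma> \<and> f x (l 4) = - \<sigma> \<and> f x (l 5) = \<sigma>"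
    using six_signs[OF units ineqs] by (rule bexE)
  let ?type = "\<lambda>i. \<forall>j\<in>{1, 2, 3, 4, 5, 6}. j \<noteq> i \<longrightarrow> f x (l j) = \<sigma> * sg (Ltour 6) i j"
  from \<sigma>(2) have "?type 1 \<or> ?type 2 \<or> ?type 3 \<or> ?type 4 \<or> ?type 5 \<or> ?type 6"
    by (simp add: sg_Ltour sg_Ltour_rev)
  then show ?thesis
    using \<sigma>(1) unfolding interval_1_6 by blast
qed

section \<open>Sign patterns of blowups\<close>

text \<open>\<open>\<tau>\<close> assigns to each vertex its block, and \<open>d = -1\<close> on the vertices to be switched.\<close>

definition blowup_signs ::
    "nat \<Rightarrow> 'a set \<Rightarrow> ('a \<Rightarrow> 'a \<Rightarrow> int) \<Rightarrow> ('a \<Rightarrow> nat) \<Rightarrow> ('a \<Rightarrow> int) \<Rightarrow> bool" where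
  "blowup_signs m V f \<tau> d \<longleftrightarrow> (\<forall>x\<in>V. \<tau> x \<in> {1..m}) \<and> (\<forall>i\<in>{1..m}. \<exists>x\<in>V. \<tau> x = i) \<and>
     (\<forall>x\<in>V. d x \<in> {1, -1}) \<and>
     (\<forall>x\<in>V. \<forall>y\<in>V. \<tau> x \<noteq> \<tau> y \<longrightarrow> d x * d y * f x y = sg (Ltour m) (\<tau> x) (\<tau> y)) \<and>
     (\<forall>x\<in>V. \<forall>y\<in>V. \<forall>z\<in>V. \<tau> x = \<tau> z \<longrightarrow> \<tau> y = \<tau> z \<longrightarrow>
        \<not> (d x * d y * f x y = 1 \<and> d y * d z * f y z = 1 \<and> d z * d x * f z x = 1))"

lemma blowup_signs_sign_change:
  assumes "blowup_signs m V (\<lambda>x y. c x * c y * f x y) \<tau> d" "\<And>x. x \<in> V \<Longrightarrow> c x \<in> {1, -1}"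
  shows "blowup_signs m V f \<tau> (\<lambda>x. d x * c x)"
proof -
  have eq: "d x * c x * (d y * c y) * f x y = d x * d y * (c x * c y * f x y)" for x y
    by simp
  have "d x * c x \<in> {1, -1}" if "x \<in> V" for x
    using assms that unfolding blowup_signs_def by fastforce
  then show ?thesis
    using assms(1) unfolding blowup_signs_def eq by blast
qed

text \<open>Each vertex gets a matching row as its type \<tau> and the matching sign as
  \<open>d\<close>. Switching by \<open>d\<close> makes every vertex see the copy like its type, and
  \<open>typed_copy\<close> applies.\<close>

lemma (in sign_system) classify_exact:
  assumes m: "m \<in> {4, 6}"
    and l: "\<And>i. i \<in> {1..m} \<Longrightarrow> l i \<in> V" "inj_on l {1..m}"
    and exact: "\<And>i j. i \<in> {1..m} \<Longrightarrow> j \<in> {1..m} \<Longrightarrow> f (l i) (l j) = sg (Ltour m) i j"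
    and no6: "m = 4 \<Longrightarrow> \<not> contains_L 6 V f"
  shows "\<exists>\<tau> d. blowup_signs m V f \<tau> d"
proof -
  have "\<exists>i\<in>{1..m}. \<exists>\<sigma>\<in>{1, -1}. \<forall>j\<in>{1..m}. j \<noteq> i \<longrightarrow> f x (l j) = \<sigma> * sg (Ltour m) i j"
    if x: "x \<in> V" for x
  proof (cases "x \<in> l ` {1..m}")
    case True
    then obtain i where i: "i \<in> {1..m}" "x = l i" by blast
    then show ?thesis
      by (intro bexI[of _ i] bexI[of _ 1]) (auto simp: exact)
  next
    case False
    consider "m = 4" | "m = 6" using m by blast
    then show ?thesis
    proof cases
      case 1
      have "f x (l j) \<in> {1, -1}" if "j \<in> {1..4}" for j
      proof (rule unit[OF x l(1)])
        show "j \<in> {1..m}" "x \<noteq> l j" using that 1 False by auto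
      qed
      then show ?thesis
        unfolding 1 by (rule sign_vector_type_4)
    next
      case 2
      show ?thesis
        using l exact x False unfolding 2 by (rule sign_vector_type_6)
    qed
  qed
  then have "\<forall>x\<in>V. \<exists>i \<sigma>. i \<in> {1..m} \<and> \<sigma> \<in> {1, -1} \<and>
      (\<forall>j\<in>{1..m}. j \<noteq> i \<longrightarrow> f x (l j) = \<sigma> * sg (Ltour m) i j)"
    by blast
  from bchoice[OF this] obtain \<tau> where "\<forall>x\<in>V. \<exists>\<sigma>. \<tau> x \<in> {1..m} \<and> \<sigma> \<in> {1, -1} \<and>
      (\<forall>j\<in>{1..m}. j \<noteq> \<tau> x \<longrightarrow> f x (l j) = \<sigma> * sg (Ltour m) (\<tau> x) j)"
    by (rule exE)
  from bchoice[OF this] obtain d where t: "\<forall>x\<in>V. \<tau> x \<in> {1..m} \<and> d x \<in> {1, -1} \<and>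
      (\<forall>j\<in>{1..m}. j \<noteq> \<tau> x \<longrightarrow> f x (l j) = d x * sg (Ltour m) (\<tau> x) j)"
    by (rule exE)
  then have \<tau>: "\<tau> x \<in> {1..m}" and d: "d x \<in> {1, -1}"
    and f: "\<And>j. j \<in> {1..m} \<Longrightarrow> j \<noteq> \<tau> x \<Longrightarrow> f x (l j) = d x * sg (Ltour m) (\<tau> x) j"
    if "x \<in> V" for x
    using that by blast+
  have unit_L: "sg (Ltour m) i j \<in> {1, -1}" if "i \<in> {1..m}" "j \<in> {1..m}" "i \<noteq> j" for i j
    using sg_unit[OF tournament_Ltour, of i m j] that by simp
  \<comment> \<open>Types were chosen arbitrarily, so those of the copy itself need an argument:
    with another type, the diagonal zero at \<open>l i\<close> would equal a sign.\<close>
  have \<tau>_l: "\<tau> (l i) = i" if i: "i \<in> {1..m}" for i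
  proof (rule ccontr)
    assume neq: "\<tau> (l i) \<noteq> i"
    then have "0 = d (l i) * sg (Ltour m) (\<tau> (l i)) i"
      using f[OF l(1)[OF i] i] skew_self[OF skew, of "l i"] by simp
    then show False
      using d[OF l(1)[OF i]] unit_L[OF \<tau>[OF l(1)[OF i]] i neq] by auto
  qed
  \<comment> \<open>Any \<open>j\<close> other than \<open>i\<close> compares a nonzero entry with
    \<open>d (l i)\<close> times itself, so switching by \<open>d\<close> leaves the copy
    fixed.\<close>
  have d_l: "d (l i) = 1" if i: "i \<in> {1..m}" for i
  proof -
    obtain j where j: "j \<in> {1..m}" "j \<noteq> i"
    proof (cases "i = 1")
      case True
      then show ?thesis using m that[of 2] by auto
    next
      case False
      then show ?thesis using m that[of 1] by auto
    qed
    then have "sg (Ltour m) i j = d (l i) * sg (Ltour m) i j"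
      using f[OF l(1)[OF i] j(1)] exact[OF i j(1)] \<tau>_l[OF i] by simp
    then show ?thesis
      using unit_L[OF i j(1)] j(2) by auto
  qed
  let ?g = "\<lambda>x y. d x * d y * f x y"
  interpret g: sign_system V ?g
    by (rule sign_change) (rule d)
  interpret typed_copy V ?g m l \<tau>
  proof
    show "d x * d (l j) * f x (l j) = sg (Ltour m) (\<tau> x) j"
      if "x \<in> V" "j \<in> {1..m}" "j \<noteq> \<tau> x" for x j
      using f[OF that] d_l[OF that(2)] d[OF that(1)] by auto
  qed (use m l \<tau>_l \<tau> in auto)
  have no6': "\<not> contains_L 6 V ?g" if "m = 4"
    using contains_L_sign_change[of 6 V d f] d no6[OF that] by blast
  have "\<exists>x\<in>V. \<tau> x = i" if "i \<in> {1..m}" for i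
    using l(1) \<tau>_l that by blast
  then have "blowup_signs m V f \<tau> d"
    unfolding blowup_signs_def
    using \<tau> d cross_consistent no6' block_acyclic by (intro conjI ballI impI notI) blast+
  then show ?thesis by blast
qed

lemma (in sign_system) classify:
  assumes m: "m \<in> {4, 6}" and L: "contains_L m V f" and no6: "m = 4 \<Longrightarrow> \<not> contains_L 6 V f"
  shows "\<exists>\<tau> d. blowup_signs m V f \<tau> d"
proof -
  obtain e s where es: "inj_on e {1..m}" "e ` {1..m} \<subseteq> V" "\<And>i. s i \<in> {1, -1 :: int}"
    and eq: "\<And>i j. i \<in> {1..m} \<Longrightarrow> j \<in> {1..m} \<Longrightarrow> f (e i) (e j) = s i * s j * sg (Ltour m) i j"
    using L unfolding contains_L_def by blast
  \<comment> \<open>\<open>c\<close> carries the signs \<open>s\<close> from indices to vertices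
    along the inverse of \<open>e\<close>, with default 1 off the copy; switching by
    \<open>c\<close> makes the copy exact.\<close>
  define c where "c x = (if x \<in> e ` {1..m} then s (the_inv_into {1..m} e x) else 1)" for x
  let ?g = "\<lambda>x y. c x * c y * f x y"
  have c: "c x \<in> {1, -1}" for x
    using es(3) unfolding c_def by simp
  have c_e: "c (e i) = s i" if "i \<in> {1..m}" for i
    using that the_inv_into_f_f[OF es(1) that] by (simp add: c_def)
  interpret g: sign_system V ?g
    by (rule sign_change) (rule c)
  have "\<exists>\<tau> d. blowup_signs m V ?g \<tau> d"
  proof (rule g.classify_exact[OF m _ es(1)])
    show "e i \<in> V" if "i \<in> {1..m}" for i using es(2) that by blast
    show "c (e i) * c (e j) * f (e i) (e j) = sg (Ltour m) i j"
      if "i \<in> {1..m}" "j \<in> {1..m}" for i j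
      using es(3)[of i] es(3)[of j] by (auto simp: c_e[OF that(1)] c_e[OF that(2)] eq[OF that])
    show "\<not> contains_L 6 V ?g" if "m = 4"
      using contains_L_sign_change[of 6 V c f] c no6[OF that] by blast
  qed
  then show ?thesis
    using blowup_signs_sign_change c by blast
qed

text \<open>Blocks correspond to fibres of \<tau> and the switched set to \<open>d = -1\<close>;
  this turns the question into one on sign matrices.\<close>

lemma switching_blowup_iff:
  assumes T: "tournament T"
  shows "switching_equivalent_to_blowup_of T (Ltour m) \<longleftrightarrow>
    (\<exists>\<tau> d. blowup_signs m (pverts T) (sg T) \<tau> d)"
proof
  assume "\<exists>\<tau> d. blowup_signs m (pverts T) (sg T) \<tau> d"
  then obtain \<tau> d where "blowup_signs m (pverts T) (sg T) \<tau> d" by blast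
  then show "switching_equivalent_to_blowup_of T (Ltour m)"
    unfolding blowup_signs_def by (intro switching_blowupI[OF T, of \<tau> m d]) blast+
next
  assume "switching_equivalent_to_blowup_of T (Ltour m)"
  then obtain a B where a: "\<forall>i\<in>{1..m}. 0 < a i" and blowup: "is_transitive_blowup B (Ltour m) a"
    and "switching_equivalent T B"
    unfolding switching_equivalent_to_blowup_of_def Ltour_verts by blast
  from this(3) obtain W where W: "B = switch T W"
    unfolding switching_equivalent_def by blast
  have B: "tournament B"
    using blowup unfolding is_transitive_blowup_def by (rule conjunct1)
  obtain P where dis: "disjoint_family_on P {1..m}" and verts: "pverts B = (\<Union>i\<in>{1..m}. P i)"
    and blocks: "\<forall>i\<in>{1..m}. card (P i) = a i \<and> transitive_tournament (induced B (P i))"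
    and arcs: "\<forall>i j. (i, j) \<in> parcs (Ltour m) \<longrightarrow> (\<forall>x\<in>P i. \<forall>y\<in>P j. (x, y) \<in> parcs B)"
    using blowup unfolding is_transitive_blowup_def Ltour_verts by (elim conjE exE)
  define d :: "'a \<Rightarrow> int" where "d x = (if x \<in> W then -1 else 1)" for x
  \<comment> \<open>The description is unique for every vertex of \<open>T\<close> because the
    blocks are disjoint.\<close>
  define \<tau> where "\<tau> x = (THE i. i \<in> {1..m} \<and> x \<in> P i)" for x
  have sg_B: "sg B x y = d x * d y * sg T x y" for x y
    unfolding W d_def by (rule sg_switch[OF T])
  have V: "pverts T = (\<Union>i\<in>{1..m}. P i)"
    using verts by (simp add: W switch_def)
  have \<tau>_eq: "\<tau> x = i" if "i \<in> {1..m}" "x \<in> P i" for x i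
    unfolding \<tau>_def
  proof (rule the_equality)
    show "i \<in> {1..m} \<and> x \<in> P i" using that by blast
    show "j = i" if "j \<in> {1..m} \<and> x \<in> P j" for j
      using dis that \<open>i \<in> {1..m}\<close> \<open>x \<in> P i\<close> unfolding disjoint_family_on_def by blast
  qed
  have \<tau>: "\<tau> x \<in> {1..m} \<and> x \<in> P (\<tau> x)" if "x \<in> pverts T" for x
    using that \<tau>_eq unfolding V by blast
  have "\<exists>x\<in>pverts T. \<tau> x = i" if "i \<in> {1..m}" for i
  proof -
    have "P i \<noteq> {}" using a blocks that by fastforce
    then show ?thesis using \<tau>_eq that unfolding V by blast
  qed
  moreover have "d x * d y * sg T x y = sg (Ltour m) (\<tau> x) (\<tau> y)"
    if xyT: "x \<in> pverts T" "y \<in> pverts T" "\<tau> x \<noteq> \<tau> y" for x y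
  proof -
    have xy: "x \<in> P (\<tau> x)" "y \<in> P (\<tau> y)" using \<tau> xyT by blast+
    consider "(\<tau> x, \<tau> y) \<in> parcs (Ltour m)" | "(\<tau> y, \<tau> x) \<in> parcs (Ltour m)"
      using tournament.one_arc[OF tournament_Ltour, of "\<tau> x" m "\<tau> y", unfolded Ltour_verts] \<tau> xyT
      by blast
    then show ?thesis
    proof cases
      case 1
      then have "(x, y) \<in> parcs B" using arcs xy by blast
      then show ?thesis using 1 unfolding sg_B[symmetric] by (simp add: sg_def)
    next
      case 2
      then have "(y, x) \<in> parcs B" using arcs xy by blast
      then show ?thesis
        using 2 tournament_asym[OF B] tournament_asym[OF tournament_Ltour]
        unfolding sg_B[symmetric] by (simp add: sg_def)
    qed
  qed
  moreover have "\<not> (d x * d y * sg T x y = 1 \<and> d y * d z * sg T y z = 1 \<and> d z * d x * sg T z x = 1)"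
    if "x \<in> pverts T" "y \<in> pverts T" "z \<in> pverts T" "\<tau> x = \<tau> z" "\<tau> y = \<tau> z" for x y z
  proof -
    have P: "x \<in> P (\<tau> z)" "y \<in> P (\<tau> z)" "z \<in> P (\<tau> z)"
      using \<tau>[OF that(1)] \<tau>[OF that(2)] \<tau>[OF that(3)] that(4,5) by simp_all
    have "transitive_tournament (induced B (P (\<tau> z)))"
      using blocks \<tau>[OF that(3)] by blast
    then have "\<not> ((x, y) \<in> parcs (induced B (P (\<tau> z))) \<and> (y, z) \<in> parcs (induced B (P (\<tau> z))) \<and>
        (z, x) \<in> parcs (induced B (P (\<tau> z))))"
      unfolding transitive_tournament_def by blast
    then show ?thesis
      unfolding sg_B[symmetric] sg_eq_1_iff by (simp add: induced_def P)
  qed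
  moreover have "d x \<in> {1, -1}" for x by (simp add: d_def)
  ultimately have "blowup_signs m (pverts T) (sg T) \<tau> d"
    unfolding blowup_signs_def using \<tau> by (intro conjI ballI impI) blast+
  then show "\<exists>\<tau> d. blowup_signs m (pverts T) (sg T) \<tau> d" by blast
qed

section \<open>Determinants of blowups\<close>

lemma blowup_signs_contains_L:
  assumes "blowup_signs m V f \<tau> d" "skew f"
  shows "contains_L m V f"
proof -
  \<comment> \<open>One vertex from every block gives the copy, with the values of \<open>d\<close>
    as its signs.\<close>
  have "\<forall>i\<in>{1..m}. \<exists>x. x \<in> V \<and> \<tau> x = i"
    using assms(1) unfolding blowup_signs_def by blast
  from bchoice[OF this] obtain e where e: "\<And>i. i \<in> {1..m} \<Longrightarrow> e i \<in> V" "\<And>i. i \<in> {1..m} \<Longrightarrow> \<tau> (e i) = i"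
    by blast
  let ?s = "\<lambda>i. if i \<in> {1..m} then d (e i) else 1"
  have d: "d x \<in> {1, -1}" if "x \<in> V" for x
    using assms(1) that unfolding blowup_signs_def by blast
  have "f (e i) (e j) = ?s i * ?s j * sg (Ltour m) i j" if "i \<in> {1..m}" "j \<in> {1..m}" for i j
  proof (cases "i = j")
    case True
    then show ?thesis by (simp add: skew_self[OF assms(2)] skew_self[OF skew_Ltour])
  next
    case False
    then have "d (e i) * d (e j) * f (e i) (e j) = sg (Ltour m) i j"
      using assms(1) e[OF that(1)] e[OF that(2)] unfolding blowup_signs_def by metis
    then show ?thesis
      using d[OF e(1)[OF that(1)]] d[OF e(1)[OF that(2)]] that by auto
  qed
  moreover have "inj_on e {1..m}"
    by (rule inj_on_inverseI[of _ \<tau>]) (rule e(2))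
  moreover have "e ` {1..m} \<subseteq> V" using e(1) by blast
  moreover have "?s i \<in> {1, -1}" for i using d e(1) by simp
  ultimately show ?thesis
    unfolding contains_L_def by (intro exI[of _ e] exI[of _ ?s] conjI allI ballI)
qed

text \<open>The copy alone is a violating minor, since switching does not change its
  determinant.\<close>

lemma contains_L_unbounded:
  assumes "contains_L m V f" "m \<in> {4, 6}" "c < (int m - 1)\<^sup>2"
  shows "\<not> sdet_bounded V f c"
proof -
  obtain e s where es: "inj_on e {1..m}" "e ` {1..m} \<subseteq> V" "\<And>i. s i \<in> {1, -1 :: int}"
    and eq: "\<And>i j. i \<in> {1..m} \<Longrightarrow> j \<in> {1..m} \<Longrightarrow> f (e i) (e j) = s i * s j * sg (Ltour m) i j"
    using assms(1) unfolding contains_L_def by blast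
  have set: "set [1..<Suc m] = {1..m}" by auto
  have "sdet f (map e [1..<Suc m]) = sdet (\<lambda>i j. s i * s j * sg (Ltour m) i j) [1..<Suc m]"
    unfolding sdet_map by (rule sdet_cong) (simp only: set eq)
  also have "\<dots> = sdet (sg (Ltour m)) [1..<Suc m]"
    by (rule sdet_sign_change) (rule es(3))
  also have "\<dots> = (int m - 1)\<^sup>2"
    by (rule sdet_Ltour[OF _ set assms(2)]) simp
  finally have "sdet f (map e [1..<Suc m]) > c"
    using assms(3) by simp
  moreover have "distinct (map e [1..<Suc m])" "set (map e [1..<Suc m]) \<subseteq> V"
    using es(1,2) unfolding distinct_map set_map set by simp_all
  ultimately show ?thesis
    unfolding sdet_bounded_def by (meson not_le)
qed

text \<open>On \<open>A\<close> the relation \<open>g x y = 1\<close> is a strict linear order, and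
  any other vertex lies before both or after both of two consecutive ones.\<close>

lemma acyclic_twins:
  assumes "skew g" and unit: "\<And>x y. x \<in> A \<Longrightarrow> y \<in> A \<Longrightarrow> x \<noteq> y \<Longrightarrow> g x y \<in> {1, -1 :: int}"
    and acyc: "\<And>x y z. x \<in> A \<Longrightarrow> y \<in> A \<Longrightarrow> z \<in> A \<Longrightarrow> g x y = 1 \<Longrightarrow> g y z = 1 \<Longrightarrow> g z x \<noteq> 1"
    and "finite A" "a \<in> A" "b \<in> A" "a \<noteq> b"
  obtains x y where "x \<in> A" "y \<in> A" "x \<noteq> y" "\<And>w. w \<in> A \<Longrightarrow> w \<noteq> x \<Longrightarrow> w \<noteq> y \<Longrightarrow> g x w = g y w"
proof -
  have rev: "g y x = - g x y" for x y by (rule skewD[OF assms(1)])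
  have self: "g x x = 0" for x by (rule skew_self[OF assms(1)])
  have trans: "g x z = 1" if "x \<in> A" "y \<in> A" "z \<in> A" "g x y = 1" "g y z = 1" for x y z
  proof -
    have "x \<noteq> z" using that(4,5) rev[of x y] by auto
    then have "g x z \<in> {1, -1}" using unit that by blast
    moreover have "g z x \<noteq> 1" using acyc that by blast
    ultimately show ?thesis using rev[of z x] by auto
  qed
  \<comment> \<open>A pair with the fewest vertices in between is consecutive in the transitive order.\<close>
  define between where "between p = {w \<in> A. g (fst p) w = 1 \<and> g w (snd p) = 1}" for p
  define Q where "Q p \<longleftrightarrow> fst p \<in> A \<and> snd p \<in> A \<and> g (fst p) (snd p) = 1" for p
  have "\<exists>p. Q p"
  proof -
    have "g a b = 1 \<or> g b a = 1"
      using unit[OF assms(5,6,7)] rev[of a b] by auto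
    then have "Q (a, b) \<or> Q (b, a)" using assms(5,6) by (simp add: Q_def)
    then show ?thesis by blast
  qed
  then obtain p where p: "Q p" "\<And>q. Q q \<Longrightarrow> card (between p) \<le> card (between q)"
    using ex_has_least_nat[of Q _ "\<lambda>p. card (between p)"] by blast
  obtain x y where xy: "p = (x, y)" by (cases p)
  have x: "x \<in> A" and y: "y \<in> A" and gxy: "g x y = 1" using p(1) by (simp_all add: xy Q_def)
  have empty: "\<not> (g x z = 1 \<and> g z y = 1)" if z: "z \<in> A" for z
  proof
    assume *: "g x z = 1 \<and> g z y = 1"
    have "between (x, z) \<subseteq> between (x, y)"
      using trans[OF _ z y] * by (auto simp: between_def)
    moreover have "z \<in> between (x, y)" "z \<notin> between (x, z)"
      using z * self by (auto simp: between_def)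
    moreover have "finite (between (x, y))" using assms(4) by (simp add: between_def)
    ultimately have "card (between (x, z)) < card (between (x, y))"
      by (intro psubset_card_mono) auto
    moreover have "Q (x, z)" using x z * by (simp add: Q_def)
    ultimately show False using p(2)[of "(x, z)"] by (simp add: xy)
  qed
  have "g x w = g y w" if w: "w \<in> A" "w \<noteq> x" "w \<noteq> y" for w
  proof (cases "g x w = 1")
    case True
    then have "g w y \<noteq> 1" using empty[OF w(1)] by blast
    then have "g w y = -1" using unit[OF w(1) y w(3)] by blast
    then show ?thesis using True rev[of y w] by simp
  next
    case False
    then have xw: "g x w = -1" using unit[OF x w(1)] w(2) by blast
    then have "g w x = 1" using rev[of w x] by simp
    then have "g w y = 1" using trans[OF w(1) x y] gxy by blast
    then show ?thesis using xw rev[of y w] by simp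
  qed
  moreover have "x \<noteq> y" using gxy self by auto
  ultimately show ?thesis using that[OF x y] by blast
qed

text \<open>Odd sizes give 0. On four vertices the Pfaffian is a sum of three signs, so the minor is
  at most 9, and four vertices require \<open>m \<ge> 4\<close>. Six vertices exhaust
  \<open>L\<^sub>6\<close>.\<close>

lemma sdet_Ltour_sublist_le:
  assumes "m \<in> {2, 4, 6}" "distinct js" "set js \<subseteq> {1..m}"
  shows "sdet (sg (Ltour m)) js \<le> (int m - 1)\<^sup>2"
proof -
  have sq: "1 \<le> (int m - 1)\<^sup>2" using assms(1) by auto
  have unit: "sg (Ltour m) i j \<in> {1, -1}" if "i \<in> set js" "j \<in> set js" "i \<noteq> j" for i j
    using sg_unit[OF tournament_Ltour, of i m j, unfolded Ltour_verts] that assms(3) by blast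
  have abs1: "\<bar>sg (Ltour m) i j\<bar> = 1" if "i \<in> set js" "j \<in> set js" "i \<noteq> j" for i j
    using unit[OF that] by auto
  have len: "length js \<le> m"
    using card_mono[OF _ assms(3)] distinct_card[OF assms(2)] by simp
  show ?thesis
  proof (cases "odd (length js)")
    case True
    then show ?thesis using sdet_odd[OF skew_Ltour] sq by simp
  next
    case False
    have "m \<le> 6" using assms(1) by auto
    then have "length js \<le> 6" using len by simp
    with False have "length js = 0 \<or> length js = 2 \<or> length js = 4 \<or> length js = 6"
      by presburger
    then consider "length js = 0" | "length js = 2" | "length js = 4" | "length js = 6"
      by blast
    then show ?thesis
    proof cases
      case 1
      then show ?thesis using sq by simp
    next
      case 2
      then obtain i j where js: "js = [i, j]"
        by (auto simp: numeral_eq_Suc length_Suc_conv)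
      have "(sg (Ltour m) i j)\<^sup>2 = 1"
        using unit[of i j] assms(2) unfolding js by auto
      then show ?thesis
        using sq unfolding js sdet_2[OF skew_Ltour] by simp
    next
      case 3
      then obtain i j k l where js: "js = [i, j, k, l]"
        by (rule list_length_4E)
      let ?r = "sg (Ltour m)"
      have "\<bar>pf4 ?r i j k l\<bar> \<le> \<bar>?r i j * ?r k l\<bar> + \<bar>?r i k * ?r j l\<bar> + \<bar>?r i l * ?r j k\<bar>"
        unfolding pf4_def by linarith
      also have "\<dots> = 3"
        using assms(2) abs1 unfolding js by (simp add: abs_mult)
      finally have "\<bar>pf4 ?r i j k l\<bar>\<^sup>2 \<le> 3\<^sup>2"
        by (intro power_mono) auto
      moreover have "3\<^sup>2 \<le> (int m - 1)\<^sup>2"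
        using assms(1) len 3 by auto
      ultimately show ?thesis
        unfolding js sdet_4[OF skew_Ltour] by simp
    next
      case 4
      then have m: "m = 6" using len \<open>m \<le> 6\<close> by simp
      have "set js = {1..m}"
        using card_subset_eq[OF _ assms(3)] distinct_card[OF assms(2)] 4 m by simp
      then show ?thesis using sdet_Ltour[OF assms(2)] m by simp
    qed
  qed
qed

text \<open>Two listed vertices in one block yield twins, whose deletion preserves the determinant.
  Once no block repeats, the minor is one of \<open>Ltour m\<close> itself.\<close>

lemma blowup_signs_bounded:
  assumes bs: "blowup_signs m V f \<tau> d" and m: "m \<in> {2, 4, 6}" and f: "skew f"
    and unit: "\<And>x y. x \<in> V \<Longrightarrow> y \<in> V \<Longrightarrow> x \<noteq> y \<Longrightarrow> f x y \<in> {1, -1}"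
  shows "sdet_bounded V f ((int m - 1)\<^sup>2)"
proof -
  let ?g = "\<lambda>x y. d x * d y * f x y"
  have \<tau>: "\<And>x. x \<in> V \<Longrightarrow> \<tau> x \<in> {1..m}" and d: "\<And>x. x \<in> V \<Longrightarrow> d x \<in> {1, -1}"
    and cross: "\<And>x y. x \<in> V \<Longrightarrow> y \<in> V \<Longrightarrow> \<tau> x \<noteq> \<tau> y \<Longrightarrow> ?g x y = sg (Ltour m) (\<tau> x) (\<tau> y)"
    and acyc: "\<And>x y z. x \<in> V \<Longrightarrow> y \<in> V \<Longrightarrow> z \<in> V \<Longrightarrow> \<tau> x = \<tau> z \<Longrightarrow> \<tau> y = \<tau> z \<Longrightarrow>
      ?g x y = 1 \<Longrightarrow> ?g y z = 1 \<Longrightarrow> ?g z x \<noteq> 1"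
    using bs unfolding blowup_signs_def by blast+
  have g: "skew ?g" by (rule skew_scale[OF f])
  have unit_g: "?g x y \<in> {1, -1}" if "x \<in> V" "y \<in> V" "x \<noteq> y" for x y
    using unit[OF that] d[OF that(1)] d[OF that(2)] by auto
  have "sdet ?g vs \<le> (int m - 1)\<^sup>2" if "distinct vs" "set vs \<subseteq> V" for vs
    using that
  proof (induction vs rule: length_induct)
    case (1 vs)
    show ?case
    proof (cases "inj_on \<tau> (set vs)")
      case True
      have "sdet ?g vs = sdet (\<lambda>x y. sg (Ltour m) (\<tau> x) (\<tau> y)) vs"
      proof (rule sdet_cong)
        fix x y assume xy: "x \<in> set vs" "y \<in> set vs"
        show "?g x y = sg (Ltour m) (\<tau> x) (\<tau> y)"
        proof (cases "x = y")
          case True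
          then show ?thesis by (simp add: skew_self[OF f] skew_self[OF skew_Ltour])
        next
          case False
          then have "\<tau> x \<noteq> \<tau> y" using inj_onD[OF \<open>inj_on \<tau> (set vs)\<close> _ xy] by blast
          then show ?thesis using cross 1(3) xy by blast
        qed
      qed
      also have "\<dots> = sdet (sg (Ltour m)) (map \<tau> vs)" by (simp only: sdet_map)
      also have "\<dots> \<le> (int m - 1)\<^sup>2"
        by (rule sdet_Ltour_sublist_le[OF m]) (use 1(2,3) \<tau> True in \<open>auto simp: distinct_map\<close>)
      finally show ?thesis .
    next
      case False
      then obtain a b where ab: "a \<in> set vs" "b \<in> set vs" "a \<noteq> b" "\<tau> a = \<tau> b"
        by (auto simp: inj_on_def)
      \<comment> \<open>Only the listed part of the block counts: twins have to agree on the list,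
        so consecutive means consecutive within \<open>A\<close>.\<close>
      define A where "A = {w \<in> set vs. \<tau> w = \<tau> b}"
      have AV: "A \<subseteq> V" using 1(3) by (auto simp: A_def)
      obtain x y where xy: "x \<in> A" "y \<in> A" "x \<noteq> y"
        and tw: "\<And>w. w \<in> A \<Longrightarrow> w \<noteq> x \<Longrightarrow> w \<noteq> y \<Longrightarrow> ?g x w = ?g y w"
      proof (rule acyclic_twins[OF g, of A a b])
        show "?g x y \<in> {1, -1}" if "x \<in> A" "y \<in> A" "x \<noteq> y" for x y
          using unit_g AV that by blast
        show "?g z x \<noteq> 1" if "x \<in> A" "y \<in> A" "z \<in> A" "?g x y = 1" "?g y z = 1" for x y z
        proof (rule acyc[OF _ _ _ _ _ that(4,5)])
          show "\<tau> x = \<tau> z" "\<tau> y = \<tau> z" using that by (simp_all add: A_def)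
        qed (use that AV in blast)+
      qed (use ab in \<open>auto simp: A_def\<close>)
      have V: "x \<in> V" "y \<in> V" using xy AV by blast+
      define ws where "ws = filter (\<lambda>w. w \<noteq> x \<and> w \<noteq> y) vs"
      have ws: "distinct ws" "set ws = set vs - {x, y}"
        using 1(2) by (auto simp: ws_def)
      have vs: "x \<in> set vs" "y \<in> set vs" using xy by (simp_all add: A_def)
      have "sdet ?g vs = sdet ?g (x # y # ws)"
        by (rule sdet_distinct_cong) (use 1(2) ws vs xy(3) in auto)
      also have "\<dots> = sdet ?g ws"
      proof (rule sdet_twins[OF g unit_g[OF V xy(3)]])
        fix w assume "w \<in> set ws"
        then have w: "w \<in> set vs" "w \<noteq> x" "w \<noteq> y" using ws by auto
        show "?g x w = ?g y w"
        proof (cases "\<tau> w = \<tau> b")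
          case True
          then show ?thesis using w by (intro tw) (auto simp: A_def)
        next
          case False
          have "\<tau> x = \<tau> b" "\<tau> y = \<tau> b" using xy by (simp_all add: A_def)
          moreover have "w \<in> V" using w(1) 1(3) by blast
          ultimately show ?thesis
            using cross[OF V(1), of w] cross[OF V(2), of w] False by simp
        qed
      qed
      also have "\<dots> \<le> (int m - 1)\<^sup>2"
      proof -
        have "length ws < length vs"
          unfolding ws_def by (rule length_filter_less[OF vs(1)]) simp
        then show ?thesis using 1 ws by blast
      qed
      finally show ?thesis .
    qed
  qed
  moreover have "sdet ?g vs = sdet f vs" if "set vs \<subseteq> V" for vs
    by (rule sdet_sign_change) (use d that in blast)
  ultimately show ?thesis
    unfolding sdet_bounded_def by (intro allI impI) (simp only:)
qed

text \<open>After a switching that makes \<open>z\<close> dominate everything, a 3-cycle among the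
  other vertices forms \<open>L\<^sub>4\<close> with \<open>z\<close>, up to switching. Without such
  a cycle the other vertices are a transitive block.\<close>

lemma blowup_of_L2_or_contains_L4:
  assumes T: "tournament T" and card: "card (pverts T) \<ge> 2"
  shows "switching_equivalent_to_blowup_of T (Ltour 2) \<or> contains_L 4 (pverts T) (sg T)"
proof -
  obtain z y where zy: "z \<in> pverts T" "y \<in> pverts T" "y \<noteq> z"
    using card by (auto simp: numeral_2_eq_2 card_le_Suc_iff)
  define d where "d x = (if x = z then 1 else sg T z x)" for x
  define g where "g = (\<lambda>x y. d x * d y * sg T x y)"
  note unit = sg_unit[OF T]
  have d: "d x \<in> {1, -1}" if "x \<in> pverts T" for x
    using unit[OF zy(1) that] by (simp add: d_def)
  have gz: "g z x = 1" if "x \<in> pverts T" "x \<noteq> z" for x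
    using unit[OF zy(1) that(1)] that(2) by (auto simp: g_def d_def)
  have skew_g: "skew g" unfolding g_def by (rule skew_scale[OF skew_sg[OF T]])
  show ?thesis
  proof (cases "\<exists>a b c. a \<in> pverts T \<and> b \<in> pverts T \<and> c \<in> pverts T \<and> g a b = 1 \<and> g b c = 1 \<and> g c a = 1")
    case True
    then obtain a b c where abc: "a \<in> pverts T" "b \<in> pverts T" "c \<in> pverts T"
      "g a b = 1" "g b c = 1" "g c a = 1" by blast
    have no_z: "g x z \<noteq> 1" if "x \<in> pverts T" for x
      using gz[OF that] skewD[OF skew_g, of x z] skew_self[OF skew_g, of z] by (cases "x = z") auto
    have neq: "a \<noteq> z" "b \<noteq> z" "c \<noteq> z" using abc no_z by auto
    have abc_neq: "a \<noteq> b" "b \<noteq> c" "c \<noteq> a" using abc(4-6) skew_self[OF skew_g] by auto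
    have ac: "g a c = -1" using skewD[OF skew_g, of a c] abc(6) by simp
    have "contains_L 4 (pverts T) g"
    \<comment> \<open>Switching \<open>c\<close> turns \<open>z\<close> and the 3-cycle
      \<open>a\<close>, \<open>b\<close>, \<open>c\<close> into \<open>L\<^sub>4\<close> in this
      order.\<close>
    proof (rule contains_L_listI[OF skew_g, of "[z, a, b, c]" _ "[1, 1, 1, -1]"])
      fix i j :: nat assume "i < j" "j < 4"
      then have "i = 0 \<and> j \<in> {1, 2, 3} \<or> i = 1 \<and> j \<in> {2, 3} \<or> i = 2 \<and> j = 3"
        by (auto simp: numeral_eq_Suc less_Suc_eq)
      then show "g ([z, a, b, c] ! i) ([z, a, b, c] ! j) =
          [1, 1, 1, -1] ! i * [1, 1, 1, -1] ! j * sg (Ltour 4) (Suc i) (Suc j)"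
        by (elim disjE conjE insertE emptyE; simp add: sg_Ltour gz abc ac neq)
    qed (use zy abc neq abc_neq in auto)
    then show ?thesis
      using contains_L_sign_change[of 4 "pverts T" d "sg T"] d unfolding g_def by blast
  next
    case False
    have L21: "sg (Ltour 2) 2 1 = 1" by (simp add: sg_Ltour_rev)
    have L12: "sg (Ltour 2) 1 2 = -1" by (simp add: sg_Ltour)
    have gz': "g x z = -1" if "x \<in> pverts T" "x \<noteq> z" for x
      using gz[OF that] skewD[OF skew_g, of x z] by simp
    \<comment> \<open>Block 2 is \<open>{z}\<close>, because the arc of \<open>L\<^sub>2\<close>
      goes from 2 to 1.\<close>
    have "blowup_signs 2 (pverts T) (sg T) (\<lambda>x. if x = z then 2 else 1) d"
      unfolding blowup_signs_def g_def[symmetric, unfolded fun_eq_iff, rule_format]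
    proof (intro conjI ballI impI)
      fix i :: nat assume "i \<in> {1..2}"
      then have "i = 1 \<or> i = 2" by auto
      then show "\<exists>x\<in>pverts T. (if x = z then 2 else 1) = i" using zy by auto
    next
      fix x y assume "x \<in> pverts T" "y \<in> pverts T" "(if x = z then 2 else 1 :: nat) \<noteq> (if y = z then 2 else 1)"
      then show "g x y = sg (Ltour 2) (if x = z then 2 else 1) (if y = z then 2 else 1)"
        using gz[of y] gz'[of x] L21 L12 by (auto split: if_splits)
    next
      fix x y w assume "x \<in> pverts T" "y \<in> pverts T" "w \<in> pverts T"
      then show "\<not> (g x y = 1 \<and> g y w = 1 \<and> g w x = 1)" using False by blast
    qed (use d in simp_all)
    then show ?thesis using switching_blowup_iff[OF T] by blast
  qed
qed

theorem theorem3p12: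
  fixes T :: "'a pair_pre_digraph"
  assumes "tournament T" and "card (pverts T) \<ge> 2"
  shows "(T \<in> tournaments_D 1 \<longleftrightarrow> switching_equivalent_to_blowup_of T (Ltour 2)) \<and>
    (T \<in> tournaments_D 3 - tournaments_D 1 \<longleftrightarrow> switching_equivalent_to_blowup_of T (Ltour 4)) \<and>
    (T \<in> tournaments_D 3 \<longleftrightarrow>
      (\<exists>k\<in>{2, 4}. switching_equivalent_to_blowup_of T (Ltour k))) \<and>
    (T \<in> tournaments_D 5 - tournaments_D 3 \<longleftrightarrow> switching_equivalent_to_blowup_of T (Ltour 6)) \<and>
    (T \<in> tournaments_D 5 \<longleftrightarrow>
      (\<exists>k\<in>{2, 4, 6}. switching_equivalent_to_blowup_of T (Ltour k)))"
proof -
  let ?V = "pverts T" and ?f = "sg T"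
  let ?D = "sdet_bounded ?V ?f" and ?L = "\<lambda>m. switching_equivalent_to_blowup_of T (Ltour m)"
  note T = assms(1)
  have D: "T \<in> tournaments_D 1 \<longleftrightarrow> ?D 1" "T \<in> tournaments_D 3 \<longleftrightarrow> ?D 9" "T \<in> tournaments_D 5 \<longleftrightarrow> ?D 25"
    using tournaments_D_iff[OF T, of 1] tournaments_D_iff[OF T, of 3] tournaments_D_iff[OF T, of 5]
    by simp_all
  have mono: "?D 1 \<Longrightarrow> ?D 9" "?D 9 \<Longrightarrow> ?D 25"
    unfolding sdet_bounded_def by force+
  have "?D ((int m - 1)\<^sup>2)" if "?L m" "m \<in> {2, 4, 6}" for m
    using that blowup_signs_bounded[OF _ that(2) skew_sg[OF T] sg_unit[OF T]]
    unfolding switching_blowup_iff[OF T] by blast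
  from this[of 2] this[of 4] this[of 6]
  have bounded: "?L 2 \<Longrightarrow> ?D 1" "?L 4 \<Longrightarrow> ?D 9" "?L 6 \<Longrightarrow> ?D 25"
    by simp_all
  have contains: "contains_L m ?V ?f" if "?L m" for m
    using that blowup_signs_contains_L[OF _ skew_sg[OF T]] unfolding switching_blowup_iff[OF T] by blast
  have unbounded: "contains_L 4 ?V ?f \<Longrightarrow> \<not> ?D 1" "contains_L 6 ?V ?f \<Longrightarrow> \<not> ?D 9"
    using contains_L_unbounded[of 4 ?V ?f 1] contains_L_unbounded[of 6 ?V ?f 9] by auto
  have classify: "?L m" if "?D 25" "m \<in> {4, 6}" "contains_L m ?V ?f" "m = 4 \<Longrightarrow> \<not> contains_L 6 ?V ?f" for m
  proof -
    interpret sign_system ?V ?f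
      using skew_sg[OF T] sg_unit[OF T] that(1) by unfold_locales (auto simp: sdet_bounded_def)
    show ?thesis
      unfolding switching_blowup_iff[OF T] by (rule classify[OF that(2-4)])
  qed
  have L4: "?L 4" if "?D 25" "contains_L 4 ?V ?f" "\<not> contains_L 6 ?V ?f"
    by (rule classify) (use that in simp_all)
  have L6: "?L 6" if "?D 25" "contains_L 6 ?V ?f"
    by (rule classify) (use that in simp_all)
  have L2: "?L 2 \<or> contains_L 4 ?V ?f"
    by (rule blowup_of_L2_or_contains_L4[OF assms])
  have "?D 1 \<longleftrightarrow> ?L 2"
    using L2 unbounded(1) bounded(1) by blast
  \<comment> \<open>\<open>\<not> ?D 1\<close> rules out \<open>?L 2\<close>, so \<open>L2\<close>
    provides a copy of \<open>L\<^sub>4\<close>, while \<open>?D 9\<close> excludes copies of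
    \<open>L\<^sub>6\<close>.\<close>
  moreover have "?D 9 \<and> \<not> ?D 1 \<longleftrightarrow> ?L 4"
    using L2 bounded unbounded contains[of 4] L4 mono by blast
  \<comment> \<open>\<open>\<not> ?D 9\<close> rules out \<open>?L 2\<close> and
    \<open>?L 4\<close>. The copy of \<open>L\<^sub>4\<close> given by \<open>L2\<close> would yield
    \<open>?L 4\<close> in the absence of a copy of \<open>L\<^sub>6\<close>, so one is
    present.\<close>
  moreover have "?D 25 \<and> \<not> ?D 9 \<longleftrightarrow> ?L 6"
    using L2 bounded unbounded contains[of 6] L4 L6 mono by blast
  ultimately show ?thesis
    unfolding D Diff_iff using mono by blast
qed

end
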